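(* Let $f:\mathbb{R}^n\to\mathbb{R}$ be a Borel measurable function and let $u_f:(1,+\infty)\to[1,+\infty)$ be a Remez function of $f$. Let $s\in(-\infty,1]$ and let $\mu$ be an $s$-concave probability measure on $\mathbb{R}^n$. Let $t>1$ and $\lambda>0$. If $\mu(\{x:\ |f(x)|>\lambda u_f(t)\})>0$, then for $s\neq0$ $$\mu(\{x:\ |f(x)|>\lambda\})\ge\left(\frac1t\,\mu(\{x:\ |f(x)|>\lambda u_f(t)\})^s+1-\frac1t\right)^{1/s},$$ and for $s=0$ $$\mu(\{x:\ |f(x)|>\lambda u_f(t)\})\le\mu(\{x:\ |f(x)|>\lambda\})^t.$$
   Context: A Remez function of a Borel function $f:\mathbb{R}^n\to\mathbb{R}$ is a non-decreasing function $u_f:(1,+\infty)\to[1,+\infty)$ such that for every $t>1$, every interval $I$ in $\mathbb{R}^n$ and every Borel subset $J$ of $I$ with $|I|<t|J|$, one has $\sup_I|f|\le u_f(t)\sup_J|f|$. Here an interval in $\mathbb{R}^n$ is an interval (segment) contained in an affine line, and $|\cdot|$ is one-dimensional Lebesgue measure. For $s\in(-\infty,1]$, a (Borel) measure $\mu$ on $\mathbb{R}^n$ is $s$-concave if $$\mu(\alpha A+(1-\alpha)B)\ge[\alpha\mu(A)^s+(1-\alpha)\mu(B)^s]^{1/s}$$ for all compact $A,B\subset\mathbb{R}^n$ with $\mu(A)\mu(B)>0$ and all $\alpha\in[0,1]$; for $s=0$ the right-hand side is interpreted as $\mu(A)^\alpha\mu(B)^{1-\alpha}$. *)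

theory Defs
  imports "HOL-Probability.Probability"
begin

(* The affine line through a with unit direction v. *)
definition line :: "'a::euclidean_space \<Rightarrow> 'a \<Rightarrow> 'a set" where
  "line a v = range (\<lambda>r. a + r *\<^sub>R v)"

(* One-dimensional Lebesgue measure of the part of S lying on line a v. It is the length
   of that part only if norm v = 1. *)
definition line_measure :: "'a::euclidean_space \<Rightarrow> 'a \<Rightarrow> 'a set \<Rightarrow> ennreal" where
  "line_measure a v S = emeasure lborel {r. a + r *\<^sub>R v \<in> S}"

(* An interval is a convex subset of a line, with or without its end points. Unbounded and
   one-point intervals are allowed, but never satisfy the strict inequality between the
   lengths. The suprema are taken in the extended half-line, since f may be unbounded on I.
   The values of u outside (1, oo) are irrelevant. *)
definition remez_function :: "('a::euclidean_space \<Rightarrow> real) \<Rightarrow> (real \<Rightarrow> real) \<Rightarrow> bool" where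
  "remez_function f u \<longleftrightarrow>
     mono_on {1<..} u \<and>
     (\<forall>t>1. 1 \<le> u t) \<and>
     (\<forall>t>1. \<forall>a v I J.
        norm v = 1 \<longrightarrow> I \<subseteq> line a v \<longrightarrow> convex I \<longrightarrow> J \<in> sets borel \<longrightarrow> J \<subseteq> I \<longrightarrow>
        line_measure a v I < ennreal t * line_measure a v J \<longrightarrow>
        (SUP x\<in>I. ennreal \<bar>f x\<bar>) \<le> ennreal (u t) * (SUP x\<in>J. ennreal \<bar>f x\<bar>))"

(* For finite Borel measures, so that the real-valued measure loses no information. *)
definition s_concave :: "real \<Rightarrow> 'a::euclidean_space measure \<Rightarrow> bool" where
  "s_concave s M \<longleftrightarrow>
     (\<forall>A B \<alpha>. compact A \<longrightarrow> compact B \<longrightarrow> measure M A * measure M B > 0 \<longrightarrow> 0 \<le> \<alpha> \<longrightarrow> \<alpha> \<le> 1 \<longrightarrow>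
        measure M {\<alpha> *\<^sub>R x + (1 - \<alpha>) *\<^sub>R y | x y. x \<in> A \<and> y \<in> B} \<ge>
          (if s = 0 then measure M A powr \<alpha> * measure M B powr (1 - \<alpha>)
           else (\<alpha> * measure M A powr s + (1 - \<alpha>) * measure M B powr s) powr (1 / s)))"

end

theory Submission
  imports Defs
begin

text \<open>
  With \<open>A = {|f| > l}\<close>, \<open>B = {|f| > l * u t}\<close> and \<open>\<delta> = 1 / t\<close>, the Remez property says that on every
  segment starting in \<open>B\<close> the complement of \<open>A\<close> has proportion at most \<open>\<delta>\<close>. This is all that is
  used about \<open>f\<close>.

  On a half-line with end point \<open>\<beta> \<in> B\<close>, the transform \<open>x powr s / s\<close> of the tail of the measure is
  concave, so its slope is monotone, and removing a set \<open>F\<close> that is thin as seen from \<open>\<beta>\<close> costs at most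
  the proportion \<open>\<delta>\<close> of the increment. Two such half-line estimates, glued at the point that splits the
  measure in the ratio of the parts of \<open>B\<close>, treat one gap of \<open>B\<close>; concavity of the mean in
  its first argument adds up the gaps.

  The higher-dimensional case is reduced to the line by the Lovasz-Simonovits bisection: hyperplanes
  rotating about rational subspaces of codimension two cut the body so that the proportion of \<open>B\<close> is preserved and
  that of \<open>A\<close> does not increase. The bodies shrink to a segment, and instead of passing to a limit
  measure one projects a late body to the direction of that segment. Marginals of \<open>s\<close>-concave measures are
  \<open>s\<close>-concave, and the projected sets are thin up to a small loss in \<open>\<delta>\<close>.
\<close>

section \<open>Power means\<close>

text \<open>An \<open>s_concave\<close> measure is known only through its values on compact sets. It
  may be singular, and no density is at hand whose concavity could be integrated along lines. Hence
  the one-dimensional argument works with tails on a finite grid, and the set to be removed comes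
  with a neighbourhood \<open>U\<close> wide enough for whole cells. This neighbourhood costs
  something, and so does using a late body in place of the limit segment. One strict inequality pays
  for both: if the bound fails, it fails strictly, and as the power mean is continuous in its
  weight, \<delta> can be raised to some \<delta>' < 1 with the failure intact. Two requirements
  shape the reduction to the line. Masses vary continuously with a rotating hyperplane only if
  hyperplanes are null, which is false for measures carried by an affine subspace; such subspaces
  are split off beforehand. And a late body has to avoid what the intersection of all bodies avoids,
  which forces \<open>B\<close> compact and \<open>A\<close> open; regularity of the measure removes
  this restriction at the end.\<close>

definition box_cox :: "real \<Rightarrow> real \<Rightarrow> real" where
  "box_cox s y = (if s = 0 then ln y else y powr s / s)"

text \<open>The mean generated by \<open>box_cox\<close>, with the weight \<alpha> on the first
  argument. In the final bound that argument is the mass of the small set and the other one is the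
  total mass. \<open>box_cox\<close> is the Box-Cox transform up to an additive constant; dividing
  by \<open>s\<close> makes it increasing for negative \<open>s\<close> too, so inequalities between
  means become linear ones without a discussion of signs.\<close>

definition power_mean :: "real \<Rightarrow> real \<Rightarrow> real \<Rightarrow> real \<Rightarrow> real" where
  "power_mean s \<alpha> x y =
     (if s = 0 then x powr \<alpha> * y powr (1 - \<alpha>)
      else (\<alpha> * x powr s + (1 - \<alpha>) * y powr s) powr (1 / s))"

text \<open>Both cases of \<open>box_cox\<close> share this derivative, so monotonicity, and
  concavity for \<open>s \<le> 1\<close>, need no case distinction on \<open>s\<close>.\<close>

lemma box_cox_has_derivative:
  assumes "y > 0"
  shows "(box_cox s has_real_derivative y powr (s - 1)) (at y)"
proof (cases "s = 0")
  case True
  then have "box_cox s = ln" by (auto simp: box_cox_def)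
  moreover have "y powr (s - 1) = inverse y"
    using assms True by (simp add: powr_minus powr_one)
  ultimately show ?thesis using DERIV_ln[OF assms] by simp
next
  case False
  then have "box_cox s = (\<lambda>y. y powr s / s)" by (auto simp: box_cox_def)
  moreover have "((\<lambda>y. y powr s / s) has_real_derivative s * y powr (s - 1) / s) (at y)"
    using assms by (auto intro!: derivative_eq_intros has_real_derivative_powr)
  ultimately show ?thesis using False by simp
qed

lemma box_cox_strict_mono:
  assumes "0 < x" "x < y"
  shows "box_cox s x < box_cox s y"
proof (rule DERIV_pos_imp_increasing[OF assms(2)])
  fix z assume "x \<le> z" "z \<le> y"
  with assms have "z > 0" by simp
  then show "\<exists>d. (box_cox s has_real_derivative d) (at z) \<and> 0 < d"
    using box_cox_has_derivative[of z s] by (intro exI[of _ "z powr (s - 1)"]) auto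
qed

lemma box_cox_le_iff:
  assumes "0 < x" "0 < y"
  shows "box_cox s x \<le> box_cox s y \<longleftrightarrow> x \<le> y"
  using box_cox_strict_mono[of x y s] box_cox_strict_mono[of y x s] assms
  by (cases x y rule: linorder_cases) auto

lemma box_cox_concave:
  assumes "s \<le> 1"
  shows "concave_on {0<..} (box_cox s)"
proof (rule f''_le0_imp_concave)
  fix x :: real assume "x \<in> {0<..}"
  then have x: "x > 0" by simp
  show "(box_cox s has_real_derivative x powr (s - 1)) (at x)"
    by (rule box_cox_has_derivative[OF x])
  show "((\<lambda>x. x powr (s - 1)) has_real_derivative (s - 1) * x powr (s - 1 - 1)) (at x)"
    using x by (rule has_real_derivative_powr)
  show "(s - 1) * x powr (s - 1 - 1) \<le> 0"
    using assms by (intro mult_nonpos_nonneg) auto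
qed simp

text \<open>The derivative is nonincreasing for \<open>s \<le> 1\<close>, so the same added mass
  \<open>h\<close> counts more on top of the smaller mass \<open>x\<close>. It will compare a tail
  from which a set has been removed with the full tail.\<close>

lemma box_cox_increment_antimono:
  assumes "s \<le> 1" "0 < x" "x \<le> y" "0 \<le> h"
  shows "box_cox s (y + h) - box_cox s y \<le> box_cox s (x + h) - box_cox s x"
proof -
  have "((\<lambda>z. box_cox s (z + h) - box_cox s z) has_real_derivative
          (z + h) powr (s - 1) - z powr (s - 1)) (at z)" if "z > 0" for z
    using that assms
    by (auto intro!: derivative_eq_intros DERIV_chain'[of "\<lambda>z. z + h" 1 z UNIV "box_cox s", simplified]
        box_cox_has_derivative)
  moreover have "(z + h) powr (s - 1) - z powr (s - 1) \<le> 0" if "z > 0" for z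
    using that assms by (simp add: powr_mono2')
  ultimately have "\<exists>d. ((\<lambda>z. box_cox s (z + h) - box_cox s z) has_real_derivative d) (at z) \<and> d \<le> 0"
    if "z > 0" for z using that by blast
  then show ?thesis
    using assms by (intro DERIV_nonpos_imp_nonincreasing[of x y "\<lambda>z. box_cox s (z + h) - box_cox s z"]) auto
qed

lemma weighted_sum_pos:
  fixes a b :: real
  assumes "0 \<le> \<alpha>" "\<alpha> \<le> 1" "0 < a" "0 < b"
  shows "0 < \<alpha> * a + (1 - \<alpha>) * b"
  using assms by (cases "\<alpha> = 0") (auto intro: add_pos_nonneg)

lemma power_mean_pos:
  assumes "0 \<le> \<alpha>" "\<alpha> \<le> 1" "0 < x" "0 < y"
  shows "0 < power_mean s \<alpha> x y"
  using assms weighted_sum_pos[of \<alpha> "x powr s" "y powr s"] by (auto simp: power_mean_def)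

lemma box_cox_power_mean:
  assumes "0 \<le> \<alpha>" "\<alpha> \<le> 1" "0 < x" "0 < y"
  shows "box_cox s (power_mean s \<alpha> x y) = \<alpha> * box_cox s x + (1 - \<alpha>) * box_cox s y"
proof (cases "s = 0")
  case True
  then show ?thesis using assms by (simp add: power_mean_def box_cox_def ln_mult ln_powr)
next
  case False
  then show ?thesis
    using assms weighted_sum_pos[of \<alpha> "x powr s" "y powr s"]
    by (simp add: power_mean_def box_cox_def powr_powr add_divide_distrib)
qed

lemma power_mean_le_iff:
  assumes "0 \<le> \<alpha>" "\<alpha> \<le> 1" "0 < x" "0 < y" "0 < z"
  shows "power_mean s \<alpha> x y \<le> z \<longleftrightarrow> \<alpha> * box_cox s x + (1 - \<alpha>) * box_cox s y \<le> box_cox s z"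
  using box_cox_le_iff[OF power_mean_pos[OF assms(1-4)] assms(5)] box_cox_power_mean[OF assms(1-4)]
  by metis

lemma power_mean_scale:
  assumes "0 \<le> \<alpha>" "\<alpha> \<le> 1" "0 < x" "0 < y" "0 < c"
  shows "power_mean s \<alpha> (c * x) (c * y) = c * power_mean s \<alpha> x y"
proof (cases "s = 0")
  case True
  have "c powr \<alpha> * c powr (1 - \<alpha>) = c" using assms by (simp flip: powr_add)
  then show ?thesis using assms True by (simp add: power_mean_def powr_mult mult_ac)
next
  case False
  have "\<alpha> * (c * x) powr s + (1 - \<alpha>) * (c * y) powr s
        = c powr s * (\<alpha> * x powr s + (1 - \<alpha>) * y powr s)"
    using assms by (simp add: powr_mult algebra_simps)
  then show ?thesis
    using assms False weighted_sum_pos[of \<alpha> "x powr s" "y powr s"]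
    by (simp add: power_mean_def powr_mult powr_powr)
qed

lemma power_mean_same:
  assumes "0 \<le> \<alpha>" "\<alpha> \<le> 1" "0 < x"
  shows "power_mean s \<alpha> x x = x"
proof (cases "s = 0")
  case True
  then show ?thesis using assms by (simp add: power_mean_def flip: powr_add)
next
  case False
  have "\<alpha> * x powr s + (1 - \<alpha>) * x powr s = x powr s" by (simp add: algebra_simps)
  then show ?thesis using assms False by (simp add: power_mean_def powr_powr)
qed

lemma power_mean_upper:
  assumes "0 \<le> \<alpha>" "\<alpha> \<le> 1" "0 < x" "x \<le> y"
  shows "power_mean s \<alpha> x y \<le> y"
proof -
  have y: "y > 0" using assms by simp
  have "\<alpha> * box_cox s x \<le> \<alpha> * box_cox s y"
    using assms y box_cox_le_iff[of x y s] by (intro mult_left_mono) auto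
  then show ?thesis
    using assms y by (subst power_mean_le_iff) (auto simp: algebra_simps)
qed

lemma power_mean_lower:
  assumes "0 \<le> \<alpha>" "\<alpha> \<le> 1" "0 < x" "x \<le> y"
  shows "x \<le> power_mean s \<alpha> x y"
proof -
  have y: "y > 0" using assms by simp
  have "(1 - \<alpha>) * box_cox s x \<le> (1 - \<alpha>) * box_cox s y"
    using assms y box_cox_le_iff[of x y s] by (intro mult_left_mono) auto
  then have "box_cox s x \<le> box_cox s (power_mean s \<alpha> x y)"
    using assms y by (subst box_cox_power_mean) (auto simp: algebra_simps)
  then show ?thesis
    using box_cox_le_iff[OF assms(3) power_mean_pos[OF assms(1-3) y]] by simp
qed

text \<open>The reverse Minkowski inequality. Both pairs are scaled to mean one and mixed with
  weights proportional to their means \<open>m\<close> and \<open>m'\<close>. Concavity of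
  \<open>box_cox\<close> in each coordinate shows that the mixed pair has mean at least one, and
  homogeneity scales back.\<close>

lemma power_mean_superadditive:
  assumes "s \<le> 1" "0 \<le> \<alpha>" "\<alpha> \<le> 1" "0 < x" "0 < y" "0 < x'" "0 < y'"
  shows "power_mean s \<alpha> x y + power_mean s \<alpha> x' y' \<le> power_mean s \<alpha> (x + x') (y + y')"
proof -
  define m m' where "m = power_mean s \<alpha> x y" and "m' = power_mean s \<alpha> x' y'"
  have m: "m > 0" "m' > 0" using assms by (auto simp: m_def m'_def power_mean_pos)
  have one: "\<alpha> * box_cox s (x / m) + (1 - \<alpha>) * box_cox s (y / m) = box_cox s 1"
    using box_cox_power_mean[of \<alpha> "x/m" "y/m" s] power_mean_scale[of \<alpha> x y "1/m" s] assms m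
    by (simp flip: m_def)
  have one': "\<alpha> * box_cox s (x' / m') + (1 - \<alpha>) * box_cox s (y' / m') = box_cox s 1"
    using box_cox_power_mean[of \<alpha> "x'/m'" "y'/m'" s] power_mean_scale[of \<alpha> x' y' "1/m'" s] assms m
    by (simp flip: m'_def)
  define \<theta> where "\<theta> = m' / (m + m')"
  have \<theta>: "0 \<le> \<theta>" "\<theta> \<le> 1" "1 - \<theta> = m / (m + m')" using m by (auto simp: \<theta>_def field_simps)
  have conc: "(1 - \<theta>) * box_cox s (a / m) + \<theta> * box_cox s (a' / m') \<le> box_cox s ((a + a') / (m + m'))"
    if "a > 0" "a' > 0" for a a'
  proof -
    have "(1 - \<theta>) * (a / m) + \<theta> * (a' / m') = (a + a') / (m + m')"
      unfolding \<theta>(3) using m by (simp add: \<theta>_def add_divide_distrib)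
    then show ?thesis
      using concave_onD[OF box_cox_concave[OF assms(1)], of \<theta> "a/m" "a'/m'"] that m \<theta> by simp
  qed
  have "box_cox s 1 = (1 - \<theta>) * (\<alpha> * box_cox s (x / m) + (1 - \<alpha>) * box_cox s (y / m))
      + \<theta> * (\<alpha> * box_cox s (x' / m') + (1 - \<alpha>) * box_cox s (y' / m'))"
    unfolding one one' by (simp add: algebra_simps)
  also have "\<dots> = \<alpha> * ((1 - \<theta>) * box_cox s (x / m) + \<theta> * box_cox s (x' / m'))
      + (1 - \<alpha>) * ((1 - \<theta>) * box_cox s (y / m) + \<theta> * box_cox s (y' / m'))"
    by (simp add: algebra_simps)
  also have "\<dots> \<le> \<alpha> * box_cox s ((x + x') / (m + m')) + (1 - \<alpha>) * box_cox s ((y + y') / (m + m'))"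
    using assms by (intro add_mono mult_left_mono conc) auto
  also have "\<dots> = box_cox s (power_mean s \<alpha> ((x + x') / (m + m')) ((y + y') / (m + m')))"
    using assms m by (subst box_cox_power_mean) auto
  finally have "1 \<le> power_mean s \<alpha> ((x + x') / (m + m')) ((y + y') / (m + m'))"
    using box_cox_le_iff[of 1] assms m by (simp add: power_mean_pos)
  also have "\<dots> = power_mean s \<alpha> (x + x') (y + y') / (m + m')"
    using power_mean_scale[of \<alpha> "x+x'" "y+y'" "1/(m+m')" s] assms m by simp
  finally show ?thesis using m by (simp add: field_simps flip: m_def m'_def)
qed

text \<open>Concavity in the first argument, stated for the loss
  \<open>n - power_mean s \<alpha> x n\<close>, which vanishes at \<open>x = n\<close> and so lies
  below its chord from \<open>b\<close> to \<open>n\<close>. The pair \<open>(x, n)\<close> is a sum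
  of multiples of \<open>(b, n)\<close> and \<open>(n, n)\<close>, so superadditivity applies.
  Multiplied out, the inequality also makes sense for \<open>b = n\<close>.\<close>

lemma power_mean_chord:
  assumes "s \<le> 1" "0 \<le> \<alpha>" "\<alpha> \<le> 1" "0 < b" "b \<le> x" "x \<le> n"
  shows "(n - b) * (n - power_mean s \<alpha> x n) \<le> (n - power_mean s \<alpha> b n) * (n - x)"
proof (cases "x = b \<or> x = n")
  case True
  then show ?thesis using assms power_mean_same[of \<alpha> n s] by (auto simp: mult.commute)
next
  case False
  then have lt: "b < x" "x < n" using assms by auto
  define \<theta> where "\<theta> = (n - x) / (n - b)"
  have nb: "n - b > 0" using lt by simp
  have \<theta>: "0 < \<theta>" "\<theta> < 1" using lt by (auto simp: \<theta>_def)
  have tn: "\<theta> * (n - b) = n - x" using nb by (simp add: \<theta>_def)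
  have x: "x = \<theta> * b + (1 - \<theta>) * n" using tn by (simp add: algebra_simps)
  have n: "\<theta> * n + (1 - \<theta>) * n = n" by (simp add: algebra_simps)
  have "power_mean s \<alpha> (\<theta> * b) (\<theta> * n) + power_mean s \<alpha> ((1 - \<theta>) * n) ((1 - \<theta>) * n) \<le> power_mean s \<alpha> x n"
    using power_mean_superadditive[of s \<alpha> "\<theta> * b" "\<theta> * n" "(1 - \<theta>) * n" "(1 - \<theta>) * n"] assms lt \<theta>
    unfolding x[symmetric] n by simp
  moreover have "power_mean s \<alpha> (\<theta> * b) (\<theta> * n) = \<theta> * power_mean s \<alpha> b n"
    using assms lt \<theta> by (intro power_mean_scale) auto
  moreover have "power_mean s \<alpha> ((1 - \<theta>) * n) ((1 - \<theta>) * n) = (1 - \<theta>) * n"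
    using assms lt \<theta> by (intro power_mean_same) auto
  ultimately have "n - power_mean s \<alpha> x n \<le> \<theta> * (n - power_mean s \<alpha> b n)"
    by (simp add: algebra_simps)
  then have "(n - b) * (n - power_mean s \<alpha> x n) \<le> (n - b) * (\<theta> * (n - power_mean s \<alpha> b n))"
    using nb by (intro mult_left_mono) auto
  also have "\<dots> = (n - power_mean s \<alpha> b n) * (\<theta> * (n - b))" by (simp add: mult_ac)
  finally show ?thesis by (simp add: tn)
qed

lemma tendsto_power_mean:
  assumes "(\<alpha> \<longlongrightarrow> \<alpha>0) F" "(x \<longlongrightarrow> x0) F" "(y \<longlongrightarrow> y0) F"
    and "0 \<le> \<alpha>0" "\<alpha>0 \<le> 1" "0 < x0" "0 < y0"
  shows "((\<lambda>n. power_mean s (\<alpha> n) (x n) (y n)) \<longlongrightarrow> power_mean s \<alpha>0 x0 y0) F"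
  unfolding power_mean_def
  using assms weighted_sum_pos[of \<alpha>0 "x0 powr s" "y0 powr s"]
  by (cases "s = 0") (auto intro!: tendsto_intros)

lemma s_concaveD:
  assumes "s_concave s M" "compact A" "compact B" "measure M A > 0" "measure M B > 0" "0 \<le> \<alpha>" "\<alpha> \<le> 1"
  shows "power_mean s \<alpha> (measure M A) (measure M B)
         \<le> measure M {\<alpha> *\<^sub>R x + (1 - \<alpha>) *\<^sub>R y | x y. x \<in> A \<and> y \<in> B}"
  using assms unfolding s_concave_def power_mean_def by simp

section \<open>Half-lines\<close>

text \<open>Abel summation: with \<open>h j\<close> written as \<open>h 0\<close> plus increments,
  every nonnegative increment multiplies a tail sum of \<open>d\<close>.\<close>

lemma sum_mult_mono_tail_nonneg:
  fixes h d :: "nat \<Rightarrow> real"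
  assumes "\<And>k. Suc k < m \<Longrightarrow> h k \<le> h (Suc k)" "\<And>k. k < m \<Longrightarrow> 0 \<le> (\<Sum>j=k..<m. d j)"
  shows "h 0 * (\<Sum>j<m. d j) \<le> (\<Sum>j<m. h j * d j)"
  using assms
proof (induction m arbitrary: h d)
  case 0
  then show ?case by simp
next
  case (Suc m)
  have tail: "0 \<le> (\<Sum>j=k..<m. d (Suc j))" if "k < m" for k
    using Suc.prems(2)[of "Suc k"] that by (simp flip: sum.shift_bounds_Suc_ivl)
  have IH: "h 1 * (\<Sum>j<m. d (Suc j)) \<le> (\<Sum>j<m. h (Suc j) * d (Suc j))"
    using Suc.IH[of "\<lambda>j. h (Suc j)" "\<lambda>j. d (Suc j)"] Suc.prems(1) tail by simp
  have "h 0 * (\<Sum>j<m. d (Suc j)) \<le> h 1 * (\<Sum>j<m. d (Suc j))"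
  proof (cases "m = 0")
    case False
    then show ?thesis
      using Suc.prems(1)[of 0] tail[of 0] by (intro mult_right_mono) (auto simp: atLeast0LessThan)
  qed simp
  then show ?case
    using IH by (simp add: sum.lessThan_Suc_shift algebra_simps del: sum.lessThan_Suc)
qed

text \<open>\<open>U\<close> contains a neighbourhood of \<open>F\<close>, hence all cells of a fine grid that meet \<open>F\<close>. On the other cells the
  tail of the measure off \<open>F\<close> drops as much as the full tail but from a smaller value, so its transform
  drops at least as much. Abel summation then uses that these drops are monotone along the grid.\<close>

lemma half_line_power_mean_le:
  fixes \<nu> :: "real measure"
  assumes fin: "finite_measure \<nu>" and sets: "sets \<nu> = sets borel" and sc: "s_concave s \<nu>" and s: "s \<le> 1"
    and supp: "measure \<nu> (- {p..q}) = 0"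
    and F: "F \<in> sets borel" and U: "U \<in> sets borel" and \<epsilon>: "\<epsilon> > 0" "\<And>y. y \<in> F \<Longrightarrow> {y-\<epsilon>..y+\<epsilon>} \<subseteq> U"
    and thin: "\<And>x. x \<le> \<beta> \<Longrightarrow> measure lborel (U \<inter> {x..\<beta>}) \<le> \<delta> * (\<beta> - x)"
    and \<delta>: "0 \<le> \<delta>" "\<delta> \<le> 1" and c: "c \<le> \<beta>" and pos: "measure \<nu> {\<beta>..} > 0"
  shows "power_mean s \<delta> (measure \<nu> {\<beta>..}) (measure \<nu> {c..}) \<le> measure \<nu> ({c..} - F \<inter> {..<\<beta>})"
proof (cases "c = \<beta>")
  case True
  moreover have "{\<beta>..} - F \<inter> {..<\<beta>} = {\<beta>..}" by auto
  ultimately show ?thesis using pos \<delta> by (simp add: power_mean_same)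
next
  case False
  then have c: "c < \<beta>" using c by simp
  interpret finite_measure \<nu> by fact
  note [measurable] = F U sets
  have [simp]: "S \<in> sets \<nu>" if "S \<in> sets borel" for S using that sets by simp
  \<comment> \<open>The mesh \<open>d\<close> is at most \<epsilon>, so a cell that meets
    \<open>F\<close> lies within \<epsilon> of a point of \<open>F\<close>, hence in
    \<open>U\<close>.\<close>
  obtain m :: nat where m: "real m > (\<beta> - c) / \<epsilon>" using reals_Archimedean2 by blast
  have "(\<beta> - c) / \<epsilon> > 0" using c \<epsilon> by simp
  then have m0: "m > 0" using m by (cases m) auto
  define d where "d = (\<beta> - c) / m"
  have d: "d > 0" "d \<le> \<epsilon>" using c m m0 \<epsilon> by (auto simp: d_def field_simps)
  define z where "z k = c + real k * d" for k :: nat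
  have z0: "z 0 = c" and zm: "z m = \<beta>" using m0 by (auto simp: z_def d_def)
  have zSuc: "z (Suc k) = z k + d" for k by (simp add: z_def algebra_simps)
  have zmono: "z j \<le> z k" if "j \<le> k" for j k using that d by (simp add: z_def)
  define G where "G k = measure \<nu> {z k..}" for k
  define N where "N k = measure \<nu> ({z k..} - F \<inter> {..<\<beta>})" for k
  define f where "f k \<longleftrightarrow> F \<inter> {z k..<z (Suc k)} \<noteq> {}" for k
  have NG: "N k \<le> G k" for k unfolding N_def G_def by (intro finite_measure_mono) auto
  have Nm: "N m = G m"
  proof -
    have "{\<beta>..} - F \<inter> {..<\<beta>} = {\<beta>..}" by auto
    then show ?thesis by (simp add: N_def G_def zm)
  qed
  have Nb: "G m \<le> N k" if "k \<le> m" for k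
    unfolding Nm[symmetric] N_def using zmono[OF that] by (intro finite_measure_mono) auto
  have Gm: "G m > 0" using pos by (simp add: G_def zm)
  have Npos: "N k > 0" if "k \<le> m" for k using Nb[OF that] Gm by simp
  have Gpos: "G k > 0" if "k \<le> m" for k using Npos[OF that] NG[of k] by simp
  define W where "W k = box_cox s (G k)" for k
  define V where "V k = box_cox s (N k)" for k
  define h where "h k = W k - W (Suc k)" for k
  have G_Icc: "measure \<nu> {x..max q \<beta>} = measure \<nu> {x..}" for x
  proof -
    have "measure \<nu> ({x..} - {x..max q \<beta>}) \<le> measure \<nu> (- {p..q})"
      by (intro finite_measure_mono) auto
    then have "measure \<nu> ({x..} - {x..max q \<beta>}) = 0"
      using supp measure_nonneg[of \<nu> "{x..} - {x..max q \<beta>}"] by linarith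
    moreover have "measure \<nu> ({x..} - {x..max q \<beta>}) = measure \<nu> {x..} - measure \<nu> {x..max q \<beta>}"
      by (intro finite_measure_Diff) auto
    ultimately show ?thesis by simp
  qed
  \<comment> \<open>Half-lines average to half-lines, so weight 1/2 gives midpoint concavity of
    \<open>W\<close> at three consecutive grid points. The truncation in \<open>G_Icc\<close> is
    there because \<open>s_concave\<close> speaks of compact sets only.\<close>
  have hmono: "h k \<le> h (Suc k)" if "Suc k < m" for k
  proof -
    let ?A = "{z k..max q \<beta>}" and ?B = "{z (Suc (Suc k))..max q \<beta>}"
    have "power_mean s (1/2) (G k) (G (Suc (Suc k)))
          \<le> measure \<nu> {(1/2) *\<^sub>R x + (1 - 1/2) *\<^sub>R y | x y. x \<in> ?A \<and> y \<in> ?B}"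
      using s_concaveD[OF sc, of ?A ?B "1/2"] Gpos[of k] Gpos[of "Suc (Suc k)"] that
      by (simp add: G_Icc G_def)
    also have "\<dots> \<le> measure \<nu> {z (Suc k)..}"
    proof (intro finite_measure_mono)
      show "{(1/2) *\<^sub>R x + (1 - 1/2) *\<^sub>R y | x y. x \<in> ?A \<and> y \<in> ?B} \<subseteq> {z (Suc k)..}"
        by (auto simp: zSuc)
    qed auto
    also have "\<dots> = G (Suc k)" by (simp add: G_def)
    finally have "(1/2) * W k + (1 - 1/2) * W (Suc (Suc k)) \<le> W (Suc k)"
      unfolding W_def using that Gpos by (subst power_mean_le_iff[symmetric]) auto
    then show ?thesis by (simp add: h_def)
  qed
  have hnonneg: "0 \<le> h k" if "k < m" for k
  proof -
    have "G (Suc k) \<le> G k"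
      unfolding G_def using zmono[of k "Suc k"] by (intro finite_measure_mono) auto
    then show ?thesis
      using that Gpos by (simp add: h_def W_def box_cox_le_iff)
  qed
  have step: "(if f k then 0 else h k) \<le> V k - V (Suc k)" if "k < m" for k
  proof (cases "f k")
    case True
    have "N (Suc k) \<le> N k"
      unfolding N_def using zmono[of k "Suc k"] by (intro finite_measure_mono) auto
    then show ?thesis using that Npos True by (simp add: V_def box_cox_le_iff)
  next
    case False
    let ?I = "{z k..<z (Suc k)}"
    have dis: "?I \<inter> F = {}" using False by (auto simp: f_def)
    have "{z k..} = ?I \<union> {z (Suc k)..}" using zmono[of k "Suc k"] by auto
    then have G: "G k = measure \<nu> ?I + G (Suc k)"
      unfolding G_def by (simp, subst finite_measure_Union) auto
    have "{z k..} - F \<inter> {..<\<beta>} = ?I \<union> ({z (Suc k)..} - F \<inter> {..<\<beta>})"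
      using zmono[of k "Suc k"] dis by auto
    then have N: "N k = measure \<nu> ?I + N (Suc k)"
      unfolding N_def by (simp, subst finite_measure_Union) auto
    show ?thesis
      using box_cox_increment_antimono[OF s Npos[of "Suc k"] NG[of "Suc k"], of "measure \<nu> ?I"] that False
      unfolding h_def V_def W_def G N by (simp add: add.commute)
  qed
  \<comment> \<open>\<open>h k * e k\<close> is the guaranteed drop of \<open>V\<close> on cell
    \<open>k\<close> minus \<open>1 - \<delta>\<close> times the drop of \<open>W\<close>.
    Nonnegative tail sums of \<open>e\<close> express thinness seen from \<beta>: the cells from
    \<open>k\<close> on that meet \<open>F\<close> fill at most the proportion \<delta> of
    \<open>{z k..\<beta>}\<close>.\<close>
  define e where "e k = \<delta> - (if f k then 1 else 0)" for k
  have tail: "0 \<le> (\<Sum>j=k..<m. e j)" if "k < m" for k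
  proof -
    let ?J = "{j \<in> {k..<m}. f j}"
    let ?V = "\<Union>j\<in>?J. {z j..<z (Suc j)}"
    have sub: "?V \<subseteq> U \<inter> {z k..\<beta>}"
    proof
      fix x assume "x \<in> ?V"
      then obtain j where j: "k \<le> j" "j < m" "f j" "z j \<le> x" "x < z (Suc j)" by auto
      obtain y where y: "y \<in> F" "z j \<le> y" "y < z (Suc j)" using j(3) by (auto simp: f_def)
      have "x \<in> {y-\<epsilon>..y+\<epsilon>}" using y j d zSuc[of j] by auto
      moreover have "z k \<le> x" using zmono[of k j] j by simp
      moreover have "x \<le> \<beta>" using zmono[of "Suc j" m] j zm by simp
      ultimately show "x \<in> U \<inter> {z k..\<beta>}" using \<epsilon>(2)[OF y(1)] by auto
    qed
    have dj: "disjoint_family_on (\<lambda>j. {z j..<z (Suc j)}) ?J"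
    proof (unfold disjoint_family_on_def, intro ballI impI)
      fix i j :: nat assume "i \<noteq> j"
      then have "z (Suc i) \<le> z j \<or> z (Suc j) \<le> z i"
        using zmono[of "Suc i" j] zmono[of "Suc j" i] by linarith
      then show "{z i..<z (Suc i)} \<inter> {z j..<z (Suc j)} = {}" by auto
    qed
    have "real (card ?J) * d = (\<Sum>j\<in>?J. measure lborel {z j..<z (Suc j)})"
      using zSuc d by simp
    also have "\<dots> = measure lborel ?V"
      using dj zmono by (intro measure_finite_Union[symmetric]) auto
    also have "\<dots> \<le> measure lborel (U \<inter> {z k..\<beta>})"
    proof (rule measure_mono_fmeasurable[OF sub])
      show "?V \<in> sets lborel" by auto
      have "{z k..\<beta>} \<in> fmeasurable lborel"
        using zmono[of k m] zm that by (intro fmeasurableI) auto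
      then show "U \<inter> {z k..\<beta>} \<in> fmeasurable lborel"
        by (rule fmeasurableI2) (use U in auto)
    qed
    also have "\<dots> \<le> \<delta> * (\<beta> - z k)" using zmono[of k m] zm that by (intro thin) auto
    also have "\<beta> - z k = real (m - k) * d" using zm[symmetric] that by (simp add: z_def algebra_simps of_nat_diff)
    finally have "real (card ?J) * d \<le> (\<delta> * real (m - k)) * d" by simp
    then have "real (card ?J) \<le> \<delta> * real (m - k)" using d by simp
    moreover have "(\<Sum>j=k..<m. (if f j then 1 else 0)) = real (card ?J)"
      by (subst sum.inter_filter[symmetric]) auto
    ultimately show ?thesis
      unfolding e_def by (subst sum_subtractf) (simp add: mult.commute)
  qed
  have "0 \<le> h 0 * (\<Sum>j<m. e j)"
    using hnonneg[OF m0] tail[OF m0] by (intro mult_nonneg_nonneg) (auto simp: atLeast0LessThan)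
  also have "\<dots> \<le> (\<Sum>j<m. h j * e j)"
    by (rule sum_mult_mono_tail_nonneg) (use hmono tail in auto)
  also have "\<dots> = (\<Sum>j<m. (if f j then 0 else h j) - (1 - \<delta>) * h j)"
    by (intro sum.cong) (auto simp: e_def algebra_simps)
  also have "\<dots> \<le> (\<Sum>j<m. (V j - V (Suc j)) - (1 - \<delta>) * (W j - W (Suc j)))"
    using step by (intro sum_mono) (auto simp: h_def)
  also have "\<dots> = (V 0 - V m) - (1 - \<delta>) * (W 0 - W m)"
    by (subst sum_subtractf, simp only: sum_distrib_left[symmetric] sum_lessThan_telescope')
  finally have "\<delta> * W m + (1 - \<delta>) * W 0 \<le> V 0"
    using Nm by (simp add: V_def W_def algebra_simps)
  then have "power_mean s \<delta> (G m) (G 0) \<le> N 0"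
    unfolding V_def W_def using Gm Gpos[of 0] Npos[of 0] \<delta> by (subst power_mean_le_iff) auto
  then show ?thesis by (simp add: G_def N_def zm z0)
qed

section \<open>Measures on the line\<close>

lemma measure_distr_restrict:
  fixes M :: "'a::euclidean_space measure" and X :: "'a \<Rightarrow> 'b::euclidean_space"
  assumes sets: "sets M = sets borel" and X: "X \<in> borel_measurable borel"
    and K: "K \<in> sets borel" and S: "S \<in> sets borel"
  shows "measure (distr (restrict_space M K) borel X) S = measure M (K \<inter> X -` S)"
proof -
  have sp: "space M = UNIV" using sets_eq_imp_space_eq[OF sets] by simp
  have "X \<in> measurable (restrict_space M K) borel"
    using X sets by (intro measurable_restrict_space1) (simp add: measurable_def sp)
  then have "measure (distr (restrict_space M K) borel X) S = measure (restrict_space M K) (X -` S \<inter> K)"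
    using S by (subst measure_distr) (auto simp: space_restrict_space sp)
  also have "\<dots> = measure M (X -` S \<inter> K)"
    using K sets by (intro measure_restrict_space) (auto simp: sp)
  finally show ?thesis by (simp add: Int_commute)
qed

lemma finite_measure_distr_restrict:
  fixes M :: "'a::euclidean_space measure"
  assumes "finite_measure M" "sets M = sets borel" "X \<in> borel_measurable borel" "K \<in> sets borel"
  shows "finite_measure (distr (restrict_space M K) borel X)"
proof -
  have sp: "space M = UNIV" using sets_eq_imp_space_eq[OF assms(2)] by simp
  have "finite_measure (restrict_space M K)"
    using assms by (intro finite_measure_restrict_space) (auto simp: sp)
  moreover have "X \<in> measurable (restrict_space M K) borel"
    using assms by (intro measurable_restrict_space1) (simp add: measurable_def sp)
  ultimately show ?thesis by (rule finite_measure.finite_measure_distr)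
qed

lemma compact_convex_combinations:
  fixes A B :: "'a::euclidean_space set"
  assumes "compact A" "compact B"
  shows "compact {\<alpha> *\<^sub>R x + (1 - \<alpha>) *\<^sub>R y | x y. x \<in> A \<and> y \<in> B}"
proof -
  have "{\<alpha> *\<^sub>R x + (1 - \<alpha>) *\<^sub>R y | x y. x \<in> A \<and> y \<in> B}
      = {x + y | x y. x \<in> (*\<^sub>R) \<alpha> ` A \<and> y \<in> (*\<^sub>R) (1 - \<alpha>) ` B}" by blast
  then show ?thesis
    using compact_sums[OF compact_scaling[OF assms(1)] compact_scaling[OF assms(2)]] by simp
qed

text \<open>Convex combinations of points over \<open>A\<close> and \<open>B\<close> lie over the
  combinations of \<open>A\<close> and \<open>B\<close>, because \<open>X\<close> is linear, and
  stay in \<open>K\<close>, because \<open>K\<close> is convex. Compactness of \<open>K\<close>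
  makes the preimages compact, so that \<open>s_concave\<close> can be applied to them.\<close>

lemma s_concave_distr_restrict:
  fixes M :: "'a::euclidean_space measure" and X :: "'a \<Rightarrow> 'b::euclidean_space"
  assumes fin: "finite_measure M" and sets: "sets M = sets borel" and sc: "s_concave s M"
    and X: "linear X" and K: "compact K" "convex K"
  shows "s_concave s (distr (restrict_space M K) borel X)"
proof -
  interpret finite_measure M by fact
  have cont: "continuous_on UNIV X" using X by (simp add: linear_continuous_on linear_conv_bounded_linear)
  have Xm: "X \<in> borel_measurable borel" using cont by (rule borel_measurable_continuous_onI)
  have Km: "K \<in> sets borel" using K compact_imp_closed borel_closed by blast
  note m = measure_distr_restrict[OF sets Xm Km]
  have comp: "compact (K \<inter> X -` S)" if "compact S" for S
    using K continuous_closed_vimage[of S X] cont compact_imp_closed[OF that]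
    by (intro compact_Int_closed) (auto simp: continuous_on_eq_continuous_at)
  show ?thesis unfolding s_concave_def
  proof (intro allI impI)
    fix A B :: "'b set" and \<alpha> :: real
    let ?N = "distr (restrict_space M K) borel X"
    assume A: "compact A" and B: "compact B" and pos: "measure ?N A * measure ?N B > 0"
      and \<alpha>: "0 \<le> \<alpha>" "\<alpha> \<le> 1"
    let ?A = "K \<inter> X -` A" and ?B = "K \<inter> X -` B"
    let ?C = "{\<alpha> *\<^sub>R x + (1 - \<alpha>) *\<^sub>R y | x y. x \<in> A \<and> y \<in> B}"
    have Am: "A \<in> sets borel" "B \<in> sets borel" using A B compact_imp_closed borel_closed by blast+
    have Cm: "?C \<in> sets borel"
      using compact_convex_combinations[OF A B] compact_imp_closed borel_closed by blast
    have pos': "measure M ?A > 0" "measure M ?B > 0"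
      using pos by (auto simp: m Am zero_less_mult_iff intro: less_le_trans)
    have "power_mean s \<alpha> (measure M ?A) (measure M ?B)
        \<le> measure M {\<alpha> *\<^sub>R x + (1 - \<alpha>) *\<^sub>R y | x y. x \<in> ?A \<and> y \<in> ?B}"
      using s_concaveD[OF sc comp[OF A] comp[OF B] pos' \<alpha>] .
    also have "\<dots> \<le> measure M (K \<inter> X -` ?C)"
    proof (rule finite_measure_mono)
      show "{\<alpha> *\<^sub>R x + (1 - \<alpha>) *\<^sub>R y | x y. x \<in> ?A \<and> y \<in> ?B} \<subseteq> K \<inter> X -` ?C"
        using X K(2) \<alpha> by (fastforce simp: linear_add linear_scale convex_def)
      have "X -` ?C \<inter> space borel \<in> sets borel" using Cm Xm by (rule measurable_sets[rotated])
      then show "K \<inter> X -` ?C \<in> sets M" using Km sets by simp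
    qed
    finally show "(if s = 0 then measure ?N A powr \<alpha> * measure ?N B powr (1 - \<alpha>)
        else (\<alpha> * measure ?N A powr s + (1 - \<alpha>) * measure ?N B powr s) powr (1 / s)) \<le> measure ?N ?C"
      by (simp only: m[OF Am(1)] m[OF Am(2)] m[OF Cm] power_mean_def)
  qed
qed

section \<open>Reflection, a single gap, and all gaps on the line\<close>

lemma measure_lborel_uminus:
  fixes S :: "real set"
  assumes "S \<in> sets borel"
  shows "measure lborel (uminus -` S) = measure lborel S"
proof -
  have "measure (distr lborel borel uminus) S = measure lborel (uminus -` S \<inter> space lborel)"
    using assms by (intro measure_distr) auto
  then show ?thesis by (simp add: lborel_distr_uminus)
qed

lemma measure_Int_support:
  assumes "finite_measure M" "sets M = sets borel" "measure M (- K) = 0" "K \<in> sets borel" "S \<in> sets borel"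
  shows "measure M (K \<inter> S) = measure M S"
proof -
  interpret finite_measure M by fact
  have "measure M (S - K \<inter> S) \<le> measure M (- K)"
    using assms by (intro finite_measure_mono) auto
  then have "measure M (S - K \<inter> S) = 0"
    using assms(3) measure_nonneg[of M "S - K \<inter> S"] by linarith
  then show ?thesis
    using assms finite_measure_Diff[of S "K \<inter> S"] by auto
qed

lemma half_line_power_mean_le_left:
  fixes \<nu> :: "real measure"
  assumes fin: "finite_measure \<nu>" and sets: "sets \<nu> = sets borel" and sc: "s_concave s \<nu>" and s: "s \<le> 1"
    and supp: "measure \<nu> (- {p..q}) = 0"
    and F: "F \<in> sets borel" and U: "U \<in> sets borel" and \<epsilon>: "\<epsilon> > 0" "\<And>y. y \<in> F \<Longrightarrow> {y-\<epsilon>..y+\<epsilon>} \<subseteq> U"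
    and thin: "\<And>x. \<beta> \<le> x \<Longrightarrow> measure lborel (U \<inter> {\<beta>..x}) \<le> \<delta> * (x - \<beta>)"
    and \<delta>: "0 \<le> \<delta>" "\<delta> \<le> 1" and c: "\<beta> \<le> c" and pos: "measure \<nu> {..\<beta>} > 0"
  shows "power_mean s \<delta> (measure \<nu> {..\<beta>}) (measure \<nu> {..c}) \<le> measure \<nu> ({..c} - F \<inter> {\<beta><..})"
proof -
  \<comment> \<open>Restricting to an interval of full measure changes no mass, but supplies the
    compact convex set that \<open>s_concave_distr_restrict\<close> asks for.\<close>
  let ?n = "distr (restrict_space \<nu> {p..q}) borel uminus"
  have um: "uminus \<in> borel_measurable (borel :: real measure)" by simp
  have vim: "uminus -` S \<in> sets borel" if "S \<in> sets borel" for S :: "real set"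
    using measurable_sets[OF um that] by simp
  have m: "measure ?n S = measure \<nu> (uminus -` S)" if "S \<in> sets borel" for S
    using measure_distr_restrict[OF sets um _ that, of "{p..q}"]
      measure_Int_support[OF fin sets supp _ vim[OF that]] by simp
  have eqs: "uminus -` {-c..} = {..c}" "uminus -` {-\<beta>..} = {..\<beta>}" "uminus -` {..<-\<beta>} = {\<beta><..}"
     "uminus -` (uminus -` F) = F" "uminus -` (- {-q..-p}) = - {p..q}"
    for c \<beta> p q :: real by auto
  have "power_mean s \<delta> (measure ?n {-\<beta>..}) (measure ?n {-c..})
      \<le> measure ?n ({-c..} - uminus -` F \<inter> {..<-\<beta>})"
  proof (rule half_line_power_mean_le)
    show "finite_measure ?n" using fin sets um by (rule finite_measure_distr_restrict) simp
    show "s_concave s ?n"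
      using fin sets sc by (rule s_concave_distr_restrict) (auto intro: linear_uminus module_hom_uminus)
    show "measure ?n (- {-q..-p}) = 0" using supp by (subst m) (auto simp: eqs)
    show "uminus -` F \<in> sets borel" "uminus -` U \<in> sets borel" using vim F U by auto
    show "{y-\<epsilon>..y+\<epsilon>} \<subseteq> uminus -` U" if "y \<in> uminus -` F" for y
      using \<epsilon>(2)[of "-y"] that by (auto simp: subset_eq)
    show "measure lborel (uminus -` U \<inter> {x..-\<beta>}) \<le> \<delta> * (-\<beta> - x)" if "x \<le> -\<beta>" for x
    proof -
      have "uminus -` U \<inter> {x..-\<beta>} = uminus -` (U \<inter> {\<beta>..-x})" by auto
      then have "measure lborel (uminus -` U \<inter> {x..-\<beta>}) = measure lborel (U \<inter> {\<beta>..-x})"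
        using U by (simp only: measure_lborel_uminus sets.Int borel_closed closed_atLeastAtMost)
      then show ?thesis using thin[of "-x"] that by (simp add: algebra_simps)
    qed
    show "measure ?n {-\<beta>..} > 0" using pos by (simp add: m eqs)
  qed (use s \<epsilon> \<delta> c in auto)
  moreover have "{-c..} - uminus -` F \<inter> {..<-\<beta>} \<in> sets borel" using vim F by auto
  ultimately show ?thesis by (simp add: m eqs vimage_Diff)
qed

text \<open>The gap is cut at \<open>c\<close> with \<open>\<nu> {..c} = n * b1 / (b1 + b2)\<close>, where \<open>b1\<close> and \<open>b2\<close> are the masses on both sides
  of the gap: then the two half-line bounds are proportional and add up without loss.\<close>

lemma gap_power_mean_le:
  fixes \<nu> :: "real measure"
  assumes fin: "finite_measure \<nu>" and sets: "sets \<nu> = sets borel" and sc: "s_concave s \<nu>" and s: "s \<le> 1"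
    and supp: "measure \<nu> (- {p..q}) = 0" and atom: "\<And>x. measure \<nu> {x} = 0"
    and F: "F \<in> sets borel" and U: "U \<in> sets borel" and \<epsilon>: "\<epsilon> > 0" "\<And>y. y \<in> F \<Longrightarrow> {y-\<epsilon>..y+\<epsilon>} \<subseteq> U"
    and thinl: "\<And>r x. r \<in> B \<Longrightarrow> x \<le> r \<Longrightarrow> measure lborel (U \<inter> {x..r}) \<le> \<delta> * (r - x)"
    and thinr: "\<And>r x. r \<in> B \<Longrightarrow> r \<le> x \<Longrightarrow> measure lborel (U \<inter> {r..x}) \<le> \<delta> * (x - r)"
    and \<delta>: "0 \<le> \<delta>" "\<delta> \<le> 1" and B: "compact B"
    and I: "I = connected_component_set (- B) y" "y \<notin> B" and pos: "measure \<nu> I < measure \<nu> UNIV"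
  shows "measure \<nu> (F \<inter> I)
    \<le> measure \<nu> UNIV - power_mean s \<delta> (measure \<nu> UNIV - measure \<nu> I) (measure \<nu> UNIV)"
proof -
  interpret finite_measure \<nu> by fact
  note [measurable] = F U sets
  have [simp]: "S \<in> sets \<nu>" if "S \<in> sets borel" for S using that sets by simp
  have clB: "closed B" using B compact_imp_closed by blast
  have Io: "open I" unfolding I using clB by (intro open_connected_component) auto
  have [measurable, simp]: "I \<in> sets borel" using Io by simp
  define n where "n = measure \<nu> UNIV"
  have I_iff: "x \<in> I \<longleftrightarrow> closed_segment x y \<inter> B = {}" for x
  proof
    assume x: "x \<in> I"
    have "connected I" "y \<in> I" using I by (auto simp: connected_connected_component)
    then have "closed_segment x y \<subseteq> I"
      using x by (meson convex_contains_segment connected_convex_1)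
    then show "closed_segment x y \<inter> B = {}" using I connected_component_subset[of "- B" y] by auto
  next
    assume "closed_segment x y \<inter> B = {}"
    then have "connected_component (- B) y x"
      unfolding connected_component_def by (intro exI[of _ "closed_segment x y"]) auto
    then show "x \<in> I" using I by simp
  qed
  \<comment> \<open>A side on which \<open>B\<close> has no point gets mass 0. The end point
    \<alpha> or \<beta> is then a supremum or infimum of the empty set and means nothing, so all
    facts about it are conditional.\<close>
  define b1 where "b1 = (if B \<inter> {..y} = {} then 0 else measure \<nu> {..Sup (B \<inter> {..y})})"
  define b2 where "b2 = (if B \<inter> {y..} = {} then 0 else measure \<nu> {Inf (B \<inter> {y..})..})"
  define \<alpha> where "\<alpha> = Sup (B \<inter> {..y})"
  define \<beta> where "\<beta> = Inf (B \<inter> {y..})"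
  have \<alpha>: "\<alpha> \<in> B" "\<alpha> < y" "\<And>x. x \<in> B \<Longrightarrow> x \<le> y \<Longrightarrow> x \<le> \<alpha>" if "B \<inter> {..y} \<noteq> {}"
  proof -
    have c: "compact (B \<inter> {..y})" using B by (intro compact_Int_closed) auto
    then have bd: "bdd_above (B \<inter> {..y})" by (intro bounded_imp_bdd_above compact_imp_bounded)
    have "\<alpha> \<in> B \<inter> {..y}" unfolding \<alpha>_def using c that bd
      by (intro closed_contains_Sup) (auto simp: compact_imp_closed)
    moreover have "\<alpha> \<noteq> y" using \<open>\<alpha> \<in> _\<close> I by auto
    ultimately show "\<alpha> \<in> B" "\<alpha> < y" by auto
    show "x \<le> \<alpha>" if "x \<in> B" "x \<le> y" for x
      unfolding \<alpha>_def using that bd by (intro cSup_upper) auto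
  qed
  have \<beta>: "\<beta> \<in> B" "y < \<beta>" "\<And>x. x \<in> B \<Longrightarrow> y \<le> x \<Longrightarrow> \<beta> \<le> x" if "B \<inter> {y..} \<noteq> {}"
  proof -
    have c: "compact (B \<inter> {y..})" using B by (intro compact_Int_closed) auto
    then have bd: "bdd_below (B \<inter> {y..})" by (intro bounded_imp_bdd_below compact_imp_bounded)
    have "\<beta> \<in> B \<inter> {y..}" unfolding \<beta>_def using c that bd
      by (intro closed_contains_Inf) (auto simp: compact_imp_closed)
    moreover have "\<beta> \<noteq> y" using \<open>\<beta> \<in> _\<close> I by auto
    ultimately show "\<beta> \<in> B" "y < \<beta>" by auto
    show "\<beta> \<le> x" if "x \<in> B" "y \<le> x" for x
      unfolding \<beta>_def using that bd by (intro cInf_lower) auto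
  qed
  define L where "L = (if B \<inter> {..y} = {} then {} else {..\<alpha>})"
  define R where "R = (if B \<inter> {y..} = {} then {} else {\<beta>..})"
  have Iset: "I = UNIV - L - R"
  proof (rule set_eqI)
    fix x
    show "x \<in> I \<longleftrightarrow> x \<in> UNIV - L - R"
    proof (cases "x \<le> y")
      case True
      have "x \<notin> R" using \<beta>(2) True by (auto simp: R_def not_le intro: le_less_trans)
      moreover have "closed_segment x y \<inter> B = {} \<longleftrightarrow> x \<notin> L"
      proof -
        have "closed_segment x y = {x..y}" using True by (simp add: closed_segment_eq_real_ivl)
        moreover have "{x..y} \<inter> B = {} \<longleftrightarrow> x \<notin> L"
        proof (cases "B \<inter> {..y} = {}")
          case True
          then show ?thesis by (auto simp: L_def)
        next
          case False
          show ?thesis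
          proof (cases "x \<le> \<alpha>")
            case True
            then have "\<alpha> \<in> {x..y} \<inter> B" using \<alpha>(1,2)[OF False] by simp
            then show ?thesis using False True by (auto simp: L_def)
          next
            case False': False
            then have "{x..y} \<inter> B = {}" using \<alpha>(3)[OF False] by force
            then show ?thesis using False False' by (simp add: L_def)
          qed
        qed
        ultimately show ?thesis by simp
      qed
      ultimately show ?thesis by (simp add: I_iff)
    next
      case False
      have "x \<notin> L" using \<alpha>(2) False by (auto simp: L_def not_le intro: less_trans)
      moreover have "closed_segment x y \<inter> B = {} \<longleftrightarrow> x \<notin> R"
      proof -
        have "closed_segment x y = {y..x}" using False by (simp add: closed_segment_eq_real_ivl)
        moreover have "{y..x} \<inter> B = {} \<longleftrightarrow> x \<notin> R"
        proof (cases "B \<inter> {y..} = {}")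
          case True
          then show ?thesis by (auto simp: R_def)
        next
          case False
          show ?thesis
          proof (cases "\<beta> \<le> x")
            case True
            then have "\<beta> \<in> {y..x} \<inter> B" using \<beta>(1,2)[OF False] by simp
            then show ?thesis using False True by (auto simp: R_def)
          next
            case False': False
            then have "{y..x} \<inter> B = {}" using \<beta>(3)[OF False] by force
            then show ?thesis using False False' by (simp add: R_def)
          qed
        qed
        ultimately show ?thesis by simp
      qed
      ultimately show ?thesis by (simp add: I_iff)
    qed
  qed
  have LR: "L \<inter> R = {}" using \<alpha>(2) \<beta>(2) by (force simp: L_def R_def)
  have [measurable, simp]: "L \<in> sets borel" "R \<in> sets borel" by (auto simp: L_def R_def)
  have b1: "measure \<nu> L = b1" and b2: "measure \<nu> R = b2"
    by (auto simp: L_def R_def b1_def b2_def \<alpha>_def \<beta>_def)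
  have "measure \<nu> I = n - b1 - b2"
    unfolding Iset n_def b1[symmetric] b2[symmetric]
    using LR by (subst finite_measure_Diff; (subst finite_measure_Diff)?) auto
  then have sum: "measure \<nu> UNIV - measure \<nu> I = b1 + b2" by (simp add: n_def)
  have bpos: "b1 + b2 > 0" using pos sum by simp
  have b0: "b1 \<ge> 0" "b2 \<ge> 0" by (auto simp: b1_def b2_def)
  have bn: "b1 + b2 \<le> n" using sum by (simp add: n_def algebra_simps)
  have right: "power_mean s \<delta> b2 (measure \<nu> {c..}) \<le> measure \<nu> ({c..} - F \<inter> I)"
    if "b2 > 0" "c \<le> \<beta>" for c
  proof -
    have ne: "B \<inter> {y..} \<noteq> {}" using that by (auto simp: b2_def split: if_splits)
    have b2: "b2 = measure \<nu> {\<beta>..}" using ne by (auto simp: b2_def \<beta>_def)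
    have "power_mean s \<delta> (measure \<nu> {\<beta>..}) (measure \<nu> {c..}) \<le> measure \<nu> ({c..} - F \<inter> {..<\<beta>})"
      by (rule half_line_power_mean_le[OF fin sets sc s supp F U \<epsilon>])
        (use thinl \<beta>(1)[OF ne] \<delta> that b2 in auto)
    also have "\<dots> \<le> measure \<nu> ({c..} - F \<inter> I)"
      using ne by (intro finite_measure_mono) (auto simp: Iset R_def)
    finally show ?thesis using b2 by simp
  qed
  have left: "power_mean s \<delta> b1 (measure \<nu> {..c}) \<le> measure \<nu> ({..c} - F \<inter> I)"
    if "b1 > 0" "\<alpha> \<le> c" for c
  proof -
    have ne: "B \<inter> {..y} \<noteq> {}" using that by (auto simp: b1_def split: if_splits)
    have b1: "b1 = measure \<nu> {..\<alpha>}" using ne by (auto simp: b1_def \<alpha>_def)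
    have "power_mean s \<delta> (measure \<nu> {..\<alpha>}) (measure \<nu> {..c}) \<le> measure \<nu> ({..c} - F \<inter> {\<alpha><..})"
      by (rule half_line_power_mean_le_left[OF fin sets sc s supp F U \<epsilon>])
        (use thinr \<alpha>(1)[OF ne] \<delta> that b1 in auto)
    also have "\<dots> \<le> measure \<nu> ({..c} - F \<inter> I)"
      using ne by (intro finite_measure_mono) (auto simp: Iset L_def)
    finally show ?thesis using b1 by simp
  qed
  have all: "measure \<nu> (UNIV - F \<inter> I) = n - measure \<nu> (F \<inter> I)"
    unfolding n_def by (intro finite_measure_Diff) auto
  have full: "measure \<nu> S = n" if "{p..q} \<subseteq> S" "S \<in> sets borel" for S
  proof -
    have "measure \<nu> (- S) \<le> measure \<nu> (- {p..q})" using that by (intro finite_measure_mono) auto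
    then have "measure \<nu> (UNIV - S) = 0"
      using supp measure_nonneg[of \<nu> "UNIV - S"] unfolding Compl_eq_Diff_UNIV by linarith
    then show ?thesis using finite_measure_Diff[of UNIV S] that by (simp add: n_def)
  qed
  have "power_mean s \<delta> (b1 + b2) n \<le> measure \<nu> (UNIV - F \<inter> I)"
  proof (cases "b1 = 0 \<or> b2 = 0")
    case True
    then consider "b1 = 0" "b2 > 0" | "b2 = 0" "b1 > 0" using bpos b0 by force
    then show ?thesis
    proof cases
      case 1
      \<comment> \<open>With mass on one side only, a single half-line estimate suffices: starting
        at \<open>min p \<beta>\<close>, the half-line has full mass and still contains
        \<beta>.\<close>
      have "power_mean s \<delta> b2 (measure \<nu> {min p \<beta>..}) \<le> measure \<nu> ({min p \<beta>..} - F \<inter> I)"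
        using 1 by (intro right) auto
      also have "\<dots> \<le> measure \<nu> (UNIV - F \<inter> I)" by (intro finite_measure_mono) auto
      finally show ?thesis using 1 full[of "{min p \<beta>..}"] by auto
    next
      case 2
      have "power_mean s \<delta> b1 (measure \<nu> {..max q \<alpha>}) \<le> measure \<nu> ({..max q \<alpha>} - F \<inter> I)"
        using 2 by (intro left) auto
      also have "\<dots> \<le> measure \<nu> (UNIV - F \<inter> I)" by (intro finite_measure_mono) auto
      finally show ?thesis using 2 full[of "{..max q \<alpha>}"] by auto
    qed
  next
    case False
    then have b: "b1 > 0" "b2 > 0" using b0 by auto
    have neL: "B \<inter> {..y} \<noteq> {}" and neR: "B \<inter> {y..} \<noteq> {}"
      using b by (auto simp: b1_def b2_def split: if_splits)
    have compl: "measure \<nu> {x..} = n - measure \<nu> {..x}" for x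
    proof -
      have "measure \<nu> ({..x} \<union> ({x..} - {x})) = measure \<nu> {..x} + measure \<nu> ({x..} - {x})"
        by (intro finite_measure_Union) auto
      moreover have "{..x} \<union> ({x..} - {x}) = UNIV" by auto
      moreover have "measure \<nu> ({x..} - {x}) = measure \<nu> {x..}"
        using atom[of x] finite_measure_Diff[of "{x..}" "{x}"] by simp
      ultimately show ?thesis by (simp add: n_def)
    qed
    interpret bm: finite_borel_measure \<nu> by unfold_locales (simp add: sets)
    have "continuous_on {\<alpha>..\<beta>} (cdf \<nu>)"
      using atom by (intro continuous_at_imp_continuous_on) (auto simp: bm.isCont_cdf)
    \<comment> \<open>The prescribed mass lies between \<open>b1\<close> and \<open>n - b2\<close>;
      both bounds amount to \<open>b1 + b2 \<le> n\<close>. The absence of atoms makes the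
      distribution function continuous, so the cut point \<open>c\<close> exists inside the
      gap.\<close>
    moreover have "cdf \<nu> \<alpha> \<le> n * b1 / (b1 + b2)" "n * b1 / (b1 + b2) \<le> cdf \<nu> \<beta>"
    proof -
      have "b1 = measure \<nu> {..\<alpha>}" "b2 = measure \<nu> {\<beta>..}"
        using neL neR by (auto simp: b1_def b2_def \<alpha>_def \<beta>_def)
      then have "cdf \<nu> \<alpha> = b1" "cdf \<nu> \<beta> = n - b2" using compl[of \<beta>] by (auto simp: cdf_def)
      moreover have "b1 * (b1 + b2) \<le> b1 * n" "b2 * (b1 + b2) \<le> b2 * n"
        using bn b by (auto intro: mult_left_mono)
      ultimately show "cdf \<nu> \<alpha> \<le> n * b1 / (b1 + b2)" "n * b1 / (b1 + b2) \<le> cdf \<nu> \<beta>"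
        using bpos by (auto simp: field_simps)
    qed
    ultimately obtain c where c: "\<alpha> \<le> c" "c \<le> \<beta>" "cdf \<nu> c = n * b1 / (b1 + b2)"
      using IVT'[of "cdf \<nu>" \<alpha> "n * b1 / (b1 + b2)" \<beta>] \<alpha>(2)[OF neL] \<beta>(2)[OF neR] by force
    have n: "n > 0" using bn bpos by simp
    have mc: "measure \<nu> {..c} = b1 / (b1 + b2) * n" "measure \<nu> {c..} = b2 / (b1 + b2) * n"
      using c(3) bpos unfolding compl by (auto simp: cdf_def field_simps)
    have "power_mean s \<delta> (b1 + b2) n
        = b1 / (b1 + b2) * power_mean s \<delta> (b1 + b2) n + b2 / (b1 + b2) * power_mean s \<delta> (b1 + b2) n"
      using bpos by (simp flip: add_divide_distrib distrib_right)
    also have "\<dots> = power_mean s \<delta> (b1 / (b1 + b2) * (b1 + b2)) (measure \<nu> {..c})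
        + power_mean s \<delta> (b2 / (b1 + b2) * (b1 + b2)) (measure \<nu> {c..})"
      unfolding mc using b bpos \<delta> n by (intro arg_cong2[where f="(+)"] power_mean_scale[symmetric]) auto
    also have "\<dots> = power_mean s \<delta> b1 (measure \<nu> {..c}) + power_mean s \<delta> b2 (measure \<nu> {c..})"
      using bpos by simp
    also have "\<dots> \<le> measure \<nu> ({..c} - F \<inter> I) + measure \<nu> ({c..} - F \<inter> I)"
      using left[OF b(1) c(1)] right[OF b(2) c(2)] by (rule add_mono)
    \<comment> \<open>The point \<open>c\<close> belongs to both halves; having no mass, it can be
      taken out of one of them to make the union disjoint.\<close>
    also have "measure \<nu> ({c..} - F \<inter> I) = measure \<nu> (({c..} - F \<inter> I) - {c} \<inter> ({c..} - F \<inter> I))"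
    proof -
      have "measure \<nu> ({c} \<inter> ({c..} - F \<inter> I)) \<le> measure \<nu> {c}" by (intro finite_measure_mono) auto
      then have "measure \<nu> ({c} \<inter> ({c..} - F \<inter> I)) = 0"
        using atom[of c] measure_nonneg[of \<nu> "{c} \<inter> ({c..} - F \<inter> I)"] by linarith
      then show ?thesis by (subst finite_measure_Diff) auto
    qed
    also have "measure \<nu> ({..c} - F \<inter> I) + \<dots>
        = measure \<nu> (({..c} - F \<inter> I) \<union> (({c..} - F \<inter> I) - {c} \<inter> ({c..} - F \<inter> I)))"
      by (intro finite_measure_Union[symmetric]) auto
    also have "({..c} - F \<inter> I) \<union> (({c..} - F \<inter> I) - {c} \<inter> ({c..} - F \<inter> I)) = UNIV - F \<inter> I"
      by auto
    finally show ?thesis .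
  qed
  then show ?thesis unfolding all sum by (simp add: n_def)
qed

text \<open>By compactness \<open>F\<close> meets only finitely many gaps of \<open>B\<close>. By
  \<open>power_mean_chord\<close> each of them loses at most the fraction
  \<open>(n - power_mean s \<delta> b n) / (n - b)\<close> of its mass. This fraction is the same
  for all gaps, and the gaps together have mass at most \<open>n - b\<close>.\<close>

theorem real_power_mean_le:
  fixes \<nu> :: "real measure"
  assumes fin: "finite_measure \<nu>" and sets: "sets \<nu> = sets borel" and sc: "s_concave s \<nu>" and s: "s \<le> 1"
    and supp: "measure \<nu> (- {p..q}) = 0" and atom: "\<And>x. measure \<nu> {x} = 0"
    and F: "compact F" and U: "U \<in> sets borel" and \<epsilon>: "\<epsilon> > 0" "\<And>y. y \<in> F \<Longrightarrow> {y-\<epsilon>..y+\<epsilon>} \<subseteq> U"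
    and thinl: "\<And>r x. r \<in> B \<Longrightarrow> x \<le> r \<Longrightarrow> measure lborel (U \<inter> {x..r}) \<le> \<delta> * (r - x)"
    and thinr: "\<And>r x. r \<in> B \<Longrightarrow> r \<le> x \<Longrightarrow> measure lborel (U \<inter> {r..x}) \<le> \<delta> * (x - r)"
    and \<delta>: "0 \<le> \<delta>" "\<delta> < 1" and B: "compact B" and pos: "measure \<nu> B > 0"
  shows "power_mean s \<delta> (measure \<nu> B) (measure \<nu> UNIV) \<le> measure \<nu> (- F)"
proof -
  interpret finite_measure \<nu> by fact
  have clB: "closed B" and clF: "closed F" using B F compact_imp_closed by blast+
  have [simp]: "S \<in> sets \<nu>" if "S \<in> sets borel" for S using that sets by simp
  have [simp]: "B \<in> sets borel" "F \<in> sets borel" using clB clF by auto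
  define n b where "n = measure \<nu> UNIV" and "b = measure \<nu> B"
  have b0: "b > 0" using pos by (simp add: b_def)
  have mB: "measure \<nu> (UNIV - B) = n - b"
    unfolding n_def b_def by (intro finite_measure_Diff) auto
  have bn: "b \<le> n" unfolding n_def b_def by (intro finite_measure_mono) auto
  \<comment> \<open>At a common point \<open>r\<close> the interval \<open>{r..r+\<epsilon>}\<close>
    would lie in \<open>U\<close>, and thinness would give
    \<open>\<epsilon> \<le> \<delta> * \<epsilon>\<close>, against
    \<open>\<delta> < 1\<close>.\<close>
  have dis: "F \<inter> B = {}"
  proof (rule ccontr)
    assume "F \<inter> B \<noteq> {}"
    then obtain r where r: "r \<in> F" "r \<in> B" by auto
    have "U \<inter> {r..r+\<epsilon>} = {r..r+\<epsilon>}" using \<epsilon>(2)[OF r(1)] \<epsilon>(1) by force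
    then have "\<epsilon> \<le> \<delta> * \<epsilon>" using thinr[OF r(2), of "r+\<epsilon>"] \<epsilon>(1) by simp
    then show False using \<epsilon>(1) \<delta> by simp
  qed
  have pm: "power_mean s \<delta> b n \<le> n" using power_mean_upper[of \<delta> b n s] \<delta> b0 bn by simp
  define C where "C y = connected_component_set (- B) y" for y
  have Co: "open (C y)" for y unfolding C_def using clB by (intro open_connected_component) auto
  have [simp]: "C y \<in> sets borel" for y using Co by simp
  have CB: "C y \<subseteq> UNIV - B" for y unfolding C_def using connected_component_subset[of "- B" y] by auto
  have "F \<subseteq> (\<Union>y\<in>F. C y)" using dis connected_component_refl[of _ "- B"] by (fastforce simp: C_def)
  then obtain Y where Y: "Y \<subseteq> F" "finite Y" "F \<subseteq> (\<Union>y\<in>Y. C y)"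
    using compactE_image[OF F, of F C] Co by metis
  \<comment> \<open>A set of components rather than a family over \<open>Y\<close>: points of the
    same gap must count it only once.\<close>
  define D where "D = C ` Y"
  have D: "finite D" "\<And>I. I \<in> D \<Longrightarrow> I \<in> sets borel" "\<Union>D \<subseteq> UNIV - B"
    using Y CB by (auto simp: D_def)
  have dj: "disjoint_family_on (\<lambda>I. I) D"
  proof (unfold disjoint_family_on_def, intro ballI impI)
    fix I J assume "I \<in> D" "J \<in> D" "I \<noteq> J"
    then show "I \<inter> J = {}"
      unfolding D_def C_def using connected_component_eq[of _ "- B"] by blast
  qed
  have F_eq: "F = (\<Union>I\<in>D. F \<inter> I)" using Y by (auto simp: D_def)
  have gap: "(n - b) * measure \<nu> (F \<inter> I) \<le> (n - power_mean s \<delta> b n) * measure \<nu> I" if I: "I \<in> D" for I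
  proof -
    obtain y where y: "y \<in> Y" "I = C y" using I unfolding D_def by blast
    have "measure \<nu> I \<le> measure \<nu> (UNIV - B)"
      using CB[of y] unfolding y(2) by (intro finite_measure_mono) auto
    then have le: "measure \<nu> I \<le> n - b" by (simp add: mB)
    have "measure \<nu> (F \<inter> I) \<le> measure \<nu> UNIV - power_mean s \<delta> (measure \<nu> UNIV - measure \<nu> I) (measure \<nu> UNIV)"
      by (rule gap_power_mean_le[OF fin sets sc s supp atom _ U \<epsilon> thinl thinr _ _ B])
        (use y Y dis \<delta> le b0 n_def in \<open>auto simp: C_def\<close>)
    then have "(n - b) * measure \<nu> (F \<inter> I) \<le> (n - b) * (n - power_mean s \<delta> (n - measure \<nu> I) n)"
      using bn by (intro mult_left_mono) (auto simp: n_def)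
    also have "\<dots> \<le> (n - power_mean s \<delta> b n) * (n - (n - measure \<nu> I))"
      using s \<delta> b0 le by (intro power_mean_chord) auto
    finally show ?thesis by simp
  qed
  have sumI: "(\<Sum>I\<in>D. measure \<nu> I) \<le> n - b"
  proof -
    have "(\<Sum>I\<in>D. measure \<nu> I) = measure \<nu> (\<Union>I\<in>D. I)"
      by (rule finite_measure_finite_Union[symmetric]) (use D dj in auto)
    also have "\<dots> \<le> measure \<nu> (UNIV - B)"
      using D by (intro finite_measure_mono) auto
    finally show ?thesis by (simp add: mB)
  qed
  have "measure \<nu> F \<le> (\<Sum>I\<in>D. measure \<nu> (F \<inter> I))"
    by (subst F_eq, rule finite_measure_subadditive_finite) (use D in auto)
  then have "(n - b) * measure \<nu> F \<le> (\<Sum>I\<in>D. (n - b) * measure \<nu> (F \<inter> I))"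
    using bn unfolding sum_distrib_left[symmetric] by (intro mult_left_mono) auto
  also have "\<dots> \<le> (\<Sum>I\<in>D. (n - power_mean s \<delta> b n) * measure \<nu> I)"
    by (intro sum_mono gap)
  also have "\<dots> = (n - power_mean s \<delta> b n) * (\<Sum>I\<in>D. measure \<nu> I)" by (simp add: sum_distrib_left)
  also have "\<dots> \<le> (n - power_mean s \<delta> b n) * (n - b)"
    using sumI pm by (intro mult_left_mono) auto
  finally have le: "(n - b) * measure \<nu> F \<le> (n - b) * (n - power_mean s \<delta> b n)"
    by (simp add: mult.commute)
  have compl: "measure \<nu> (- F) = n - measure \<nu> F"
    using finite_measure_Diff[of UNIV F] by (simp add: n_def Compl_eq_Diff_UNIV)
  \<comment> \<open>For \<open>n = b\<close> the inequality just obtained is void, but then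
    \<open>F\<close> lies in the null complement of \<open>B\<close>.\<close>
  show ?thesis
  proof (cases "n = b")
    case True
    have "measure \<nu> F \<le> measure \<nu> (UNIV - B)" using dis by (intro finite_measure_mono) auto
    then show ?thesis using True pm mB by (simp add: compl flip: n_def b_def)
  next
    case False
    then have "measure \<nu> F \<le> n - power_mean s \<delta> b n" using le bn by simp
    then show ?thesis by (simp add: compl flip: n_def b_def)
  qed
qed

section \<open>Bisection by hyperplanes\<close>

lemma power_mean_ge_min:
  assumes "0 \<le> \<alpha>" "\<alpha> \<le> 1" "0 < x" "0 < y"
  shows "min x y \<le> power_mean s \<alpha> x y"
proof -
  have "power_mean s \<alpha> x y = power_mean s (1 - \<alpha>) y x" by (simp add: power_mean_def algebra_simps)
  then show ?thesis
    using power_mean_lower[of \<alpha> x y s] power_mean_lower[of "1 - \<alpha>" y x s] assms by (auto simp: min_def)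
qed

text \<open>Otherwise \<open>s\<close>-concavity would give infinitely many disjoint slabs, shrinking geometrically to the
  hyperplane, with measures bounded below.\<close>

lemma hyperplane_zero_one:
  fixes M :: "'a::euclidean_space measure"
  assumes fin: "finite_measure M" and sets: "sets M = sets borel" and sc: "s_concave s M"
    and K: "compact K" and pos: "measure M (K \<inter> {x. x \<bullet> n = c}) > 0"
  shows "measure M (K \<inter> {x. x \<bullet> n \<noteq> c}) = 0"
proof (rule ccontr)
  interpret finite_measure M by fact
  have clK: "closed K" using K compact_imp_closed by blast
  have [simp]: "S \<in> sets M" if "S \<in> sets borel" for S using that sets by simp
  have [measurable]: "K \<in> sets borel" using clK by simp
  define D where "D u v = K \<inter> {x. u \<le> \<bar>x \<bullet> n - c\<bar> \<and> \<bar>x \<bullet> n - c\<bar> \<le> v}" for u v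
  have clS: "closed {x. u \<le> \<bar>x \<bullet> n - c\<bar> \<and> \<bar>x \<bullet> n - c\<bar> \<le> v}" for u v
    by (intro closed_Collect_conj closed_Collect_le continuous_intros)
  have compD: "compact (D u v)" for u v unfolding D_def using K clS by (rule compact_Int_closed)
  have [measurable]: "D u v \<in> sets borel" for u v using compD compact_imp_closed borel_closed by blast
  assume ne: "measure M (K \<inter> {x. x \<bullet> n \<noteq> c}) \<noteq> 0"
  have sub: "K \<inter> {x. x \<bullet> n \<noteq> c} \<subseteq> (\<Union>k. D (1 / real (Suc k)) (real (Suc k)))"
  proof
    fix x assume x: "x \<in> K \<inter> {x. x \<bullet> n \<noteq> c}"
    then have "\<bar>x \<bullet> n - c\<bar> > 0" by simp
    moreover obtain k :: nat where "max (1 / \<bar>x \<bullet> n - c\<bar>) \<bar>x \<bullet> n - c\<bar> < real k"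
      using reals_Archimedean2 ..
    ultimately have k: "1 / \<bar>x \<bullet> n - c\<bar> \<le> real (Suc k)" "\<bar>x \<bullet> n - c\<bar> \<le> real (Suc k)" "\<bar>x \<bullet> n - c\<bar> > 0"
      by linarith+
    then have "1 \<le> real (Suc k) * \<bar>x \<bullet> n - c\<bar>" by (subst (asm) pos_divide_le_eq) auto
    then have "1 / real (Suc k) \<le> \<bar>x \<bullet> n - c\<bar>" by (subst pos_divide_le_eq) (auto simp: mult.commute)
    then have "x \<in> D (1 / real (Suc k)) (real (Suc k))"
      using x k(2) by (simp add: D_def)
    then show "x \<in> (\<Union>k. D (1 / real (Suc k)) (real (Suc k)))" by blast
  qed
  have "\<exists>k. measure M (D (1 / real (Suc k)) (real (Suc k))) \<noteq> 0"
  proof (rule ccontr)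
    assume "\<not> ?thesis"
    then have "emeasure M (\<Union>k. D (1 / real (Suc k)) (real (Suc k))) = 0"
      by (intro emeasure_UN_eq_0) (auto simp: emeasure_eq_measure)
    then have "measure M (\<Union>k. D (1 / real (Suc k)) (real (Suc k))) = 0" by (simp add: measure_def)
    then have "measure M (K \<inter> {x. x \<bullet> n \<noteq> c}) \<le> 0"
      using finite_measure_mono[OF sub] by simp
    then show False using ne measure_nonneg[of M "K \<inter> {x. x \<bullet> n \<noteq> c}"] by linarith
  qed
  then obtain k where k: "measure M (D (1 / real (Suc k)) (real (Suc k))) > 0"
    using measure_nonneg less_eq_real_def by metis
  define v where "v = real (Suc k)"
  define u where "u = 1 / v"
  have v: "v \<ge> 1" "u > 0" "u \<le> v" by (auto simp: v_def u_def field_simps)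
  define H where "H = K \<inter> {x. x \<bullet> n = c}"
  have compH: "compact H" unfolding H_def using K closed_hyperplane[of n c]
    by (intro compact_Int_closed) (auto simp: inner_commute)
  have pH: "measure M H > 0" using pos by (simp add: H_def)
  have pD: "measure M (D u v) > 0" using k by (simp add: u_def v_def)
  define \<kappa> where "\<kappa> = min (measure M H) (measure M (D u v))"
  have \<kappa>: "\<kappa> > 0" using pH pD by (simp add: \<kappa>_def)
  \<comment> \<open>Contracting \<open>D u v\<close> towards the hyperplane by \<open>r ^ j\<close>
    gives the slab \<open>S j\<close> of distances from \<open>r ^ j * u\<close> to
    \<open>r ^ j * v\<close>. As \<open>r * v = u / 2 < u\<close>, consecutive slabs are disjoint;
    each keeps mass at least \<kappa>, since a mean is at least the minimum.\<close>
  define r where "r = u / (2 * v)"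
  have r: "0 < r" "r \<le> 1" using v by (auto simp: r_def field_simps)
  define S where "S j = {x. r ^ j * u \<le> \<bar>x \<bullet> n - c\<bar> \<and> \<bar>x \<bullet> n - c\<bar> \<le> r ^ j * v}" for j :: nat
  have [simp]: "S j \<in> sets borel" for j unfolding S_def using clS by auto
  have Sm: "\<kappa> \<le> measure M (S j)" for j
  proof -
    have rj: "0 \<le> r ^ j" "r ^ j \<le> 1" using r by (auto simp: power_le_one)
    have "\<kappa> \<le> power_mean s (1 - r ^ j) (measure M H) (measure M (D u v))"
      unfolding \<kappa>_def using rj pH pD by (intro power_mean_ge_min) auto
    also have "\<dots> \<le> measure M {(1 - r ^ j) *\<^sub>R x + (1 - (1 - r ^ j)) *\<^sub>R y | x y. x \<in> H \<and> y \<in> D u v}"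
      using rj by (intro s_concaveD[OF sc compH compD pH pD]) auto
    also have "\<dots> \<le> measure M (S j)"
    proof (intro finite_measure_mono subsetI)
      fix z assume "z \<in> {(1 - r ^ j) *\<^sub>R x + (1 - (1 - r ^ j)) *\<^sub>R y | x y. x \<in> H \<and> y \<in> D u v}"
      then obtain x y where z: "z = (1 - r ^ j) *\<^sub>R x + r ^ j *\<^sub>R y" "x \<in> H" "y \<in> D u v" by auto
      have "z \<bullet> n - c = r ^ j * (y \<bullet> n - c)"
        using z(2) unfolding z(1) by (simp add: H_def inner_add_left algebra_simps)
      then have "\<bar>z \<bullet> n - c\<bar> = r ^ j * \<bar>y \<bullet> n - c\<bar>" using rj by (simp add: abs_mult)
      then show "z \<in> S j" using z(3) rj by (auto simp: S_def D_def intro: mult_left_mono)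
    qed simp
    finally show ?thesis .
  qed
  have lt: "r ^ j * v < r ^ i * u" if "i < j" for i j
  proof -
    have "r ^ j \<le> r ^ Suc i" using that r by (intro power_decreasing) auto
    then have "r ^ j * v \<le> r ^ Suc i * v" using v by (intro mult_right_mono) auto
    also have "\<dots> = r ^ i * (u / 2)" using v by (simp add: r_def)
    also have "\<dots> < r ^ i * u" using r v by (intro mult_strict_left_mono) auto
    finally show ?thesis .
  qed
  have dj: "disjoint_family S"
    unfolding disjoint_family_on_def
  proof (intro ballI impI)
    fix i j :: nat assume "i \<noteq> j"
    then have "r ^ j * v < r ^ i * u \<or> r ^ i * v < r ^ j * u" using lt[of i j] lt[of j i] by linarith
    then show "S i \<inter> S j = {}" by (auto simp: S_def)
  qed
  obtain N :: nat where N: "measure M UNIV / \<kappa> < N" using reals_Archimedean2 by blast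
  have "real N * \<kappa> \<le> (\<Sum>j<N. measure M (S j))" using sum_mono[of "{..<N}" "\<lambda>_. \<kappa>"] Sm by simp
  also have "\<dots> = measure M (\<Union>j<N. S j)"
    using dj by (intro finite_measure_finite_Union[symmetric]) (auto simp: disjoint_family_on_def)
  also have "\<dots> \<le> measure M UNIV" by (intro finite_measure_mono) auto
  finally show False using N \<kappa> by (simp add: field_simps)
qed

text \<open>\<open>V\<close> is the orthogonal complement of the normals of all hyperplanes of full measure, so that the
  bisection is only done by null hyperplanes.\<close>

lemma essential_subspace:
  fixes M :: "'a::euclidean_space measure"
  assumes fin: "finite_measure M" and sets: "sets M = sets borel" and sc: "s_concave s M"
    and K: "compact K" "convex K"
  obtains V K' where "subspace V" "K' \<subseteq> K" "compact K'" "convex K'" "measure M (K - K') = 0"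
    "\<And>x y. x \<in> K' \<Longrightarrow> y \<in> K' \<Longrightarrow> x - y \<in> V"
    "\<And>v c. v \<in> V \<Longrightarrow> v \<noteq> 0 \<Longrightarrow> measure M (K' \<inter> {x. x \<bullet> v = c}) = 0"
proof -
  interpret finite_measure M by fact
  have [simp]: "S \<in> sets M" if "S \<in> sets borel" for S using that sets by simp
  have [measurable]: "K \<in> sets borel" using K(1) compact_imp_closed borel_closed by blast
  have null_sub: "measure M S = 0" if "measure M T = 0" "S \<subseteq> T" "T \<in> sets borel" for S T
    using finite_measure_mono[of S T] that measure_nonneg[of M S] by auto
  define P where "P n c \<longleftrightarrow> measure M (K \<inter> {x. x \<bullet> n \<noteq> c}) = 0" for n c
  have Pm: "K \<inter> {x. x \<bullet> n \<noteq> c} \<in> sets borel" for n c by measurable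
  have null_un: "measure M (S \<union> T) = 0" if "measure M S = 0" "measure M T = 0" "S \<in> sets borel" "T \<in> sets borel" for S T
    using measure_Un_le[of S M T] that measure_nonneg[of M "S \<union> T"] by auto
  define Z where "Z = {n. \<exists>c. P n c}"
  have Z: "subspace Z"
  proof (unfold subspace_def, intro conjI allI ballI)
    show "0 \<in> Z" by (auto simp: Z_def P_def intro: exI[of _ 0])
  next
    fix n m assume "n \<in> Z" "m \<in> Z"
    then obtain c d where "P n c" "P m d" by (auto simp: Z_def)
    then have "measure M (K \<inter> {x. x \<bullet> n \<noteq> c} \<union> K \<inter> {x. x \<bullet> m \<noteq> d}) = 0"
      by (intro null_un Pm) (auto simp: P_def)
    then have "P (n + m) (c + d)"
      unfolding P_def by (rule null_sub) (use Pm in \<open>auto simp: inner_add_right\<close>)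
    then show "n + m \<in> Z" by (auto simp: Z_def)
  next
    fix r n assume "n \<in> Z"
    then obtain c where "P n c" by (auto simp: Z_def)
    then have "P (r *\<^sub>R n) (r * c)"
      unfolding P_def by (rule null_sub) (use Pm in auto)
    then show "r *\<^sub>R n \<in> Z" by (auto simp: Z_def)
  qed
  \<comment> \<open>Only a finite generating set of normals is used: \<open>E\<close> then loses
    finitely many null sets, and orthogonality to \<open>Bz\<close> extends to all of
    \<open>Z\<close>.\<close>
  obtain Bz where Bz: "Bz \<subseteq> Z" "finite Bz" "span Bz = Z"
    using basis_exists[of Z] Z by (metis finiteI_independent span_minimal subset_antisym)
  obtain c where c: "\<And>n. n \<in> Bz \<Longrightarrow> P n (c n)" using Bz(1) by (auto simp: Z_def subset_iff) metis
  define E where "E = (\<Inter>n\<in>Bz. {x. n \<bullet> x = c n})"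
  have E: "closed E" "convex E"
    unfolding E_def by (auto intro!: closed_INT convex_INT closed_hyperplane convex_hyperplane)
  define V where "V = {v. \<forall>n\<in>Z. n \<bullet> v = 0}"
  show thesis
  proof (rule that[of V "K \<inter> E"])
    show "subspace V" by (auto simp: V_def subspace_def inner_add_right)
    show "compact (K \<inter> E)" "convex (K \<inter> E)" "K \<inter> E \<subseteq> K"
      using K E by (auto intro: compact_Int_closed convex_Int)
    have eq: "K - K \<inter> E = (\<Union>n\<in>Bz. K \<inter> {x. x \<bullet> n \<noteq> c n})" by (auto simp: E_def inner_commute)
    have "measure M (K - K \<inter> E) \<le> (\<Sum>n\<in>Bz. measure M (K \<inter> {x. x \<bullet> n \<noteq> c n}))"
      unfolding eq using Bz Pm by (intro finite_measure_subadditive_finite) auto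
    moreover have "(\<Sum>n\<in>Bz. measure M (K \<inter> {x. x \<bullet> n \<noteq> c n})) = 0"
      using c by (intro sum.neutral) (auto simp: P_def)
    ultimately show "measure M (K - K \<inter> E) = 0" using measure_nonneg[of M "K - K \<inter> E"] by linarith
  next
    fix x y assume "x \<in> K \<inter> E" "y \<in> K \<inter> E"
    then have "n \<bullet> (x - y) = 0" if "n \<in> Bz" for n using that by (auto simp: E_def inner_diff_right)
    moreover have "n \<bullet> (x - y) = 0" if "n \<in> span Bz" "\<And>n. n \<in> Bz \<Longrightarrow> n \<bullet> (x - y) = 0" for n
      using that by (induction rule: span_induct) (auto simp: subspace_def inner_add_left)
    ultimately show "x - y \<in> V" using Bz(3) by (auto simp: V_def)
  next
    fix v d assume v: "v \<in> V" "v \<noteq> 0"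
    \<comment> \<open>Otherwise \<open>v\<close> would be orthogonal to itself. So no hyperplane
      with normal \<open>v\<close> has full measure, and the zero-one law makes all of them
      null.\<close>
    have "v \<notin> Z" using v by (auto simp: V_def)
    then have "measure M (K \<inter> {x. x \<bullet> v \<noteq> d}) \<noteq> 0" by (auto simp: Z_def P_def)
    then have "\<not> measure M (K \<inter> {x. x \<bullet> v = d}) > 0"
      using hyperplane_zero_one[OF fin sets sc K(1)] by blast
    then have "measure M (K \<inter> {x. x \<bullet> v = d}) = 0"
      using measure_nonneg[of M "K \<inter> {x. x \<bullet> v = d}"] by linarith
    then show "measure M (K \<inter> E \<inter> {x. x \<bullet> v = d}) = 0"
      by (rule null_sub) auto
  qed
qed

text \<open>The indicators converge wherever \<open>g\<close> is nonzero, hence almost everywhere on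
  \<open>S\<close>; dominated convergence does the rest. This is the continuity needed for rotating
  half-spaces.\<close>

lemma tendsto_measure_superlevel:
  fixes M :: "'a::euclidean_space measure"
  assumes fin: "finite_measure M" and sets: "sets M = sets borel" and S: "S \<in> sets borel"
    and h: "\<And>k. h k \<in> borel_measurable borel" "g \<in> borel_measurable borel"
    and lim: "\<And>x. (\<lambda>k. h k x) \<longlonglongrightarrow> g x" and null: "measure M (S \<inter> {x. g x = 0}) = 0"
  shows "(\<lambda>k. measure M (S \<inter> {x. h k x \<ge> (0::real)})) \<longlonglongrightarrow> measure M (S \<inter> {x. g x \<ge> 0})"
proof -
  interpret finite_measure M by fact
  note [measurable] = S h
  have sp: "space M = UNIV" using sets_eq_imp_space_eq[OF sets] by simp
  have bm: "borel_measurable M = borel_measurable borel" using sets by (intro measurable_cong_sets) auto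
  let ?i = "\<lambda>A. \<lambda>x. indicator A x :: real"
  have "(\<lambda>k. integral\<^sup>L M (?i (S \<inter> {x. h k x \<ge> 0}))) \<longlonglongrightarrow> integral\<^sup>L M (?i (S \<inter> {x. g x \<ge> 0}))"
  proof (rule integral_dominated_convergence[where w = "\<lambda>_. 1"])
    show "?i (S \<inter> {x. g x \<ge> 0}) \<in> borel_measurable M" unfolding bm by measurable
    show "?i (S \<inter> {x. h k x \<ge> 0}) \<in> borel_measurable M" for k unfolding bm by measurable
    show "AE x in M. (\<lambda>k. ?i (S \<inter> {x. h k x \<ge> 0}) x) \<longlonglongrightarrow> ?i (S \<inter> {x. g x \<ge> 0}) x"
    proof (rule AE_I'[where N = "S \<inter> {x. g x = 0}"])
      show "S \<inter> {x. g x = 0} \<in> null_sets M"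
        using null sets by (auto simp: null_sets_def emeasure_eq_measure)
      show "{x \<in> space M. \<not> (\<lambda>k. ?i (S \<inter> {x. h k x \<ge> 0}) x) \<longlonglongrightarrow> ?i (S \<inter> {x. g x \<ge> 0}) x}
          \<subseteq> S \<inter> {x. g x = 0}"
      proof (rule ccontr)
        assume "\<not> ?thesis"
        then obtain x where nl: "\<not> (\<lambda>k. ?i (S \<inter> {x. h k x \<ge> 0}) x) \<longlonglongrightarrow> ?i (S \<inter> {x. g x \<ge> 0}) x"
          and x: "x \<notin> S \<inter> {x. g x = 0}" by auto
        have "eventually (\<lambda>k. ?i (S \<inter> {x. h k x \<ge> 0}) x = ?i (S \<inter> {x. g x \<ge> 0}) x) sequentially"
        proof (cases "x \<in> S")
          case True
          then consider "g x > 0" | "g x < 0" using x by force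
          then show ?thesis
          proof cases
            case 1
            then have "eventually (\<lambda>k. h k x > 0) sequentially" using lim order_tendstoD(1) by blast
            then show ?thesis by (rule eventually_mono) (use 1 in \<open>auto simp: indicator_def\<close>)
          next
            case 2
            then have "eventually (\<lambda>k. h k x < 0) sequentially" using lim order_tendstoD(2) by blast
            then show ?thesis by (rule eventually_mono) (use 2 in \<open>auto simp: indicator_def\<close>)
          qed
        qed (auto simp: indicator_def)
        from tendsto_eventually[OF this] nl show False by contradiction
      qed
    qed
  qed (auto simp: indicator_def)
  then show ?thesis by (simp add: sp)
qed

text \<open>A half-turn exchanges the sides of a hyperplane through the axis
  \<open>x \<bullet> v = q\<close>, \<open>x \<bullet> w = r\<close>. So the excess \<open>g\<close>
  of the mass of \<open>B\<close> over its share \<open>b\<close> takes opposite values at angles 0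
  and \<open>pi\<close> and vanishes in between. At such an angle both sides contain
  \<open>B\<close> in proportion \<open>b\<close>. The masses of \<open>A\<close> on the two sides
  add up, so one side does not exceed the proportion \<open>a\<close>.\<close>

lemma bisection:
  fixes M :: "'a::euclidean_space measure"
  assumes fin: "finite_measure M" and sets: "sets M = sets borel"
    and K: "compact K" and A: "A \<in> sets borel" and B: "B \<in> sets borel"
    and null: "\<And>\<theta> c. measure M (K \<inter> {x. x \<bullet> (cos \<theta> *\<^sub>R v + sin \<theta> *\<^sub>R w) = c}) = 0"
    and pos: "measure M K > 0" and b: "measure M (K \<inter> B) = b * measure M K"
    and a: "measure M (K \<inter> A) \<le> a * measure M K"
  obtains \<theta> where
    "measure M (K \<inter> {x. cos \<theta> * (x \<bullet> v - q) + sin \<theta> * (x \<bullet> w - r) \<ge> 0}) > 0"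
    "measure M (K \<inter> {x. cos \<theta> * (x \<bullet> v - q) + sin \<theta> * (x \<bullet> w - r) \<ge> 0} \<inter> B)
       = b * measure M (K \<inter> {x. cos \<theta> * (x \<bullet> v - q) + sin \<theta> * (x \<bullet> w - r) \<ge> 0})"
    "measure M (K \<inter> {x. cos \<theta> * (x \<bullet> v - q) + sin \<theta> * (x \<bullet> w - r) \<ge> 0} \<inter> A)
       \<le> a * measure M (K \<inter> {x. cos \<theta> * (x \<bullet> v - q) + sin \<theta> * (x \<bullet> w - r) \<ge> 0})"
proof -
  note thesisI = that
  interpret finite_measure M by fact
  have [simp]: "S \<in> sets M" if "S \<in> sets borel" for S using that sets by simp
  have [measurable]: "K \<in> sets borel" using K compact_imp_closed borel_closed by blast
  note [measurable] = A B
  define l where "l \<theta> x = cos \<theta> * (x \<bullet> v - q) + sin \<theta> * (x \<bullet> w - r)" for \<theta> x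
  have [measurable]: "l \<theta> \<in> borel_measurable borel" for \<theta> unfolding l_def by measurable
  have l0: "l \<theta> x = 0 \<longleftrightarrow> x \<bullet> (cos \<theta> *\<^sub>R v + sin \<theta> *\<^sub>R w) = cos \<theta> * q + sin \<theta> * r" for \<theta> x
    by (auto simp: l_def inner_add_right algebra_simps)
  have lpi: "l (\<theta> + pi) x = - l \<theta> x" for \<theta> x by (simp add: l_def)
  have nullS: "measure M (K \<inter> S \<inter> {x. l \<theta> x = 0}) = 0" if [measurable]: "S \<in> sets borel" for S \<theta>
  proof -
    have "measure M (K \<inter> S \<inter> {x. l \<theta> x = 0}) \<le> measure M (K \<inter> {x. l \<theta> x = 0})"
      by (intro finite_measure_mono) (auto, measurable)
    also have "\<dots> = 0" using null unfolding l0 .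
    finally show ?thesis using measure_nonneg[of M "K \<inter> S \<inter> {x. l \<theta> x = 0}"] by linarith
  qed
  define m where "m S \<theta> = measure M (K \<inter> S \<inter> {x. l \<theta> x \<ge> 0})" for S \<theta>
  have cont: "continuous_on UNIV (m S)" if [measurable]: "S \<in> sets borel" for S
    unfolding continuous_on_sequentially
  proof (intro allI ballI impI)
    fix \<theta> :: "nat \<Rightarrow> real" and \<theta>0 assume "(\<forall>n. \<theta> n \<in> UNIV) \<and> \<theta> \<longlonglongrightarrow> \<theta>0"
    then have "(\<lambda>k. l (\<theta> k) x) \<longlonglongrightarrow> l \<theta>0 x" for x unfolding l_def by (auto intro!: tendsto_intros)
    then show "(m S \<circ> \<theta>) \<longlonglongrightarrow> m S \<theta>0"
      unfolding comp_def m_def using nullS by (intro tendsto_measure_superlevel fin sets) auto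
  qed
  have split: "m S \<theta> + m S (\<theta> + pi) = measure M (K \<inter> S)" if [measurable]: "S \<in> sets borel" for S \<theta>
  proof -
    have "m S (\<theta> + pi) = measure M ((K \<inter> S \<inter> {x. l \<theta> x < 0}) \<union> (K \<inter> S \<inter> {x. l \<theta> x = 0}))"
      unfolding m_def by (intro arg_cong[where f = "measure M"]) (auto simp: lpi)
    also have "\<dots> = measure M (K \<inter> S \<inter> {x. l \<theta> x < 0}) + measure M (K \<inter> S \<inter> {x. l \<theta> x = 0})"
      by (intro finite_measure_Union) auto
    also have "measure M (K \<inter> S \<inter> {x. l \<theta> x = 0}) = 0" using that by (rule nullS)
    finally have "m S (\<theta> + pi) = measure M (K \<inter> S \<inter> {x. l \<theta> x < 0})" by simp
    then have "m S \<theta> + m S (\<theta> + pi) = measure M ((K \<inter> S \<inter> {x. l \<theta> x \<ge> 0}) \<union> (K \<inter> S \<inter> {x. l \<theta> x < 0}))"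
      unfolding m_def by (simp only:, intro finite_measure_Union[symmetric]) auto
    also have "(K \<inter> S \<inter> {x. l \<theta> x \<ge> 0}) \<union> (K \<inter> S \<inter> {x. l \<theta> x < 0}) = K \<inter> S" by auto
    finally show ?thesis .
  qed
  define g where "g \<theta> = m B \<theta> - b * m UNIV \<theta>" for \<theta>
  have gsum: "g \<theta> + g (\<theta> + pi) = 0" for \<theta>
    using split[of B \<theta>] split[of UNIV \<theta>] b by (simp add: g_def algebra_simps flip: distrib_left)
  have gcont: "continuous_on {0..pi} g"
    unfolding g_def using cont[of B] cont[of UNIV]
    by (intro continuous_intros) (auto intro: continuous_on_subset)
  obtain \<theta> where \<theta>: "g \<theta> = 0"
  proof (cases "g 0 \<le> 0")
    case True
    then show ?thesis using IVT'[of g 0 0 pi] gsum[of 0] gcont that by auto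
  next
    case False
    then show ?thesis using IVT2'[of g pi 0 0] gsum[of 0] gcont that by auto
  qed
  have concl: thesis if "m UNIV \<phi> > 0" "g \<phi> = 0" "m A \<phi> \<le> a * m UNIV \<phi>" for \<phi>
  proof (rule thesisI[of \<phi>], unfold l_def[symmetric])
    show "measure M (K \<inter> {x. l \<phi> x \<ge> 0}) > 0" using that(1) by (simp add: m_def)
    show "measure M (K \<inter> {x. l \<phi> x \<ge> 0} \<inter> B) = b * measure M (K \<inter> {x. l \<phi> x \<ge> 0})"
      using that(2) by (simp add: g_def m_def Int_ac)
    show "measure M (K \<inter> {x. l \<phi> x \<ge> 0} \<inter> A) \<le> a * measure M (K \<inter> {x. l \<phi> x \<ge> 0})"
      using that(3) by (simp add: m_def Int_ac)
  qed
  have zero: "m A \<phi> = 0" if "m UNIV \<phi> = 0" for \<phi>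
  proof -
    have "m A \<phi> \<le> m UNIV \<phi>" unfolding m_def by (intro finite_measure_mono) auto
    then show ?thesis using that measure_nonneg[of M "K \<inter> A \<inter> {x. l \<phi> x \<ge> 0}"] unfolding m_def by linarith
  qed
  have nn: "m S \<phi> \<ge> 0" for S \<phi> by (simp add: m_def)
  have g': "g (\<theta> + pi) = 0" using gsum[of \<theta>] \<theta> by simp
  have su: "m UNIV \<theta> + m UNIV (\<theta> + pi) = measure M K" using split[of UNIV \<theta>] by simp
  have sA: "m A \<theta> + m A (\<theta> + pi) \<le> a * m UNIV \<theta> + a * m UNIV (\<theta> + pi)"
    using split[of A \<theta>] a su by (simp flip: distrib_left)
  show thesis
  proof (cases "m UNIV \<theta> > 0 \<and> m A \<theta> \<le> a * m UNIV \<theta>")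
    case True
    then show ?thesis using concl \<theta> by blast
  next
    case False
    \<comment> \<open>The chosen side must also have positive mass: either it contains strictly less
      of \<open>A\<close> than its share, which by \<open>zero\<close> is impossible for a null
      side, or the other side is null and it has all the mass.\<close>
    have "m A (\<theta> + pi) \<le> a * m UNIV (\<theta> + pi) \<and> m UNIV (\<theta> + pi) > 0"
    proof (cases "m UNIV \<theta> > 0")
      case True
      then have lt: "m A \<theta> > a * m UNIV \<theta>" using False by simp
      then have "m A (\<theta> + pi) < a * m UNIV (\<theta> + pi)" using sA by linarith
      moreover have "m UNIV (\<theta> + pi) \<noteq> 0" using calculation zero[of "\<theta> + pi"] by auto
      ultimately show ?thesis using nn[of UNIV "\<theta> + pi"] by auto
    next
      case False
      then have "m UNIV \<theta> = 0" using nn[of UNIV \<theta>] by simp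
      then show ?thesis using sA zero[of \<theta>] su pos by auto
    qed
    then show ?thesis using concl g' by blast
  qed
qed

text \<open>The axes with rational \<open>q\<close>, \<open>r\<close> and normals in a countable set
  can be enumerated, and step \<open>n\<close> bisects at the \<open>n\<close>-th one. Later bodies
  are smaller, so a cut once made is never undone.\<close>

lemma bisection_sequence:
  fixes M :: "'a::euclidean_space measure"
  assumes fin: "finite_measure M" and sets: "sets M = sets borel"
    and K0: "compact K0" "convex K0" and A: "A \<in> sets borel" and B: "B \<in> sets borel"
    and N: "countable N"
    and null: "\<And>v w \<theta> c. v \<in> N \<Longrightarrow> w \<in> N \<Longrightarrow> v \<noteq> w \<Longrightarrow>
      measure M (K0 \<inter> {x. x \<bullet> (cos \<theta> *\<^sub>R v + sin \<theta> *\<^sub>R w) = c}) = 0"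
    and pos: "measure M K0 > 0" and b: "measure M (K0 \<inter> B) = b * measure M K0"
    and a: "measure M (K0 \<inter> A) \<le> a * measure M K0"
  obtains K :: "nat \<Rightarrow> 'a set" where
    "\<And>n. compact (K n)" "\<And>n. convex (K n)" "\<And>n. K n \<subseteq> K0" "\<And>n. K (Suc n) \<subseteq> K n"
    "\<And>n. measure M (K n) > 0" "\<And>n. measure M (K n \<inter> B) = b * measure M (K n)"
    "\<And>n. measure M (K n \<inter> A) \<le> a * measure M (K n)"
    "\<And>v w q r. v \<in> N \<Longrightarrow> w \<in> N \<Longrightarrow> v \<noteq> w \<Longrightarrow> q \<in> \<rat> \<Longrightarrow> r \<in> \<rat> \<Longrightarrow>
      \<exists>n \<theta>. K n \<subseteq> {x. cos \<theta> * (x \<bullet> v - q) + sin \<theta> * (x \<bullet> w - r) \<ge> 0}"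
proof -
  interpret finite_measure M by fact
  define S where "S = {(v, w, q, r). v \<in> N \<and> w \<in> N \<and> v \<noteq> w \<and> q \<in> (\<rat>::real set) \<and> r \<in> (\<rat>::real set)}"
  have "countable S"
    by (rule countable_subset[of _ "N \<times> N \<times> \<rat> \<times> \<rat>"]) (auto simp: S_def N countable_rat)
  define P where "P L \<longleftrightarrow> compact L \<and> convex L \<and> L \<subseteq> K0 \<and> measure M L > 0
      \<and> measure M (L \<inter> B) = b * measure M L \<and> measure M (L \<inter> A) \<le> a * measure M L" for L
  define cut where "cut p L \<longleftrightarrow> (case p of (v, w, q, r) \<Rightarrow>
      \<exists>\<theta>. L \<subseteq> {x. cos \<theta> * (x \<bullet> v - q) + sin \<theta> * (x \<bullet> w - r) \<ge> 0})" for p and L :: "'a set"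
  have step: "\<exists>L'. P L' \<and> L' \<subseteq> L \<and> (p \<in> S \<longrightarrow> cut p L')" if L: "P L" for L p
  proof (cases "p \<in> S")
    case True
    then obtain v w q r where p: "p = (v, w, q, r)" "v \<in> N" "w \<in> N" "v \<noteq> w" by (auto simp: S_def)
    have nullL: "measure M (L \<inter> {x. x \<bullet> (cos \<theta> *\<^sub>R v + sin \<theta> *\<^sub>R w) = c}) = 0" for \<theta> c
    proof -
      have "closed {x. x \<bullet> (cos \<theta> *\<^sub>R v + sin \<theta> *\<^sub>R w) = c}" by (intro closed_Collect_eq continuous_intros)
      then have "K0 \<inter> {x. x \<bullet> (cos \<theta> *\<^sub>R v + sin \<theta> *\<^sub>R w) = c} \<in> sets M"
        unfolding sets using compact_imp_closed[OF K0(1)] by (intro sets.Int borel_closed)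
      then have "measure M (L \<inter> {x. x \<bullet> (cos \<theta> *\<^sub>R v + sin \<theta> *\<^sub>R w) = c})
          \<le> measure M (K0 \<inter> {x. x \<bullet> (cos \<theta> *\<^sub>R v + sin \<theta> *\<^sub>R w) = c})"
        using L by (intro finite_measure_mono) (auto simp: P_def)
      also have "\<dots> = 0" using null p by blast
      finally show ?thesis
        using measure_nonneg[of M "L \<inter> {x. x \<bullet> (cos \<theta> *\<^sub>R v + sin \<theta> *\<^sub>R w) = c}"] by linarith
    qed
    have Lp: "compact L" "measure M L > 0" "measure M (L \<inter> B) = b * measure M L"
      "measure M (L \<inter> A) \<le> a * measure M L" using L by (auto simp: P_def)
    obtain \<theta> where \<theta>:
      "measure M (L \<inter> {x. cos \<theta> * (x \<bullet> v - q) + sin \<theta> * (x \<bullet> w - r) \<ge> 0}) > 0"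
      "measure M (L \<inter> {x. cos \<theta> * (x \<bullet> v - q) + sin \<theta> * (x \<bullet> w - r) \<ge> 0} \<inter> B)
         = b * measure M (L \<inter> {x. cos \<theta> * (x \<bullet> v - q) + sin \<theta> * (x \<bullet> w - r) \<ge> 0})"
      "measure M (L \<inter> {x. cos \<theta> * (x \<bullet> v - q) + sin \<theta> * (x \<bullet> w - r) \<ge> 0} \<inter> A)
         \<le> a * measure M (L \<inter> {x. cos \<theta> * (x \<bullet> v - q) + sin \<theta> * (x \<bullet> w - r) \<ge> 0})"
      by (rule bisection[OF fin sets Lp(1) A B nullL Lp(2-4), of q r])
    let ?H = "{x. cos \<theta> * (x \<bullet> v - q) + sin \<theta> * (x \<bullet> w - r) \<ge> 0}"
    have H: "?H = {x. (cos \<theta> *\<^sub>R v + sin \<theta> *\<^sub>R w) \<bullet> x \<ge> cos \<theta> * q + sin \<theta> * r}"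
      by (auto simp: inner_add_left inner_commute algebra_simps)
    have "closed ?H" "convex ?H" unfolding H by (auto intro: closed_halfspace_ge convex_halfspace_ge)
    then have "P (L \<inter> ?H)"
      using L \<theta> unfolding P_def by (auto intro: compact_Int_closed convex_Int)
    moreover have "cut p (L \<inter> ?H)" unfolding p cut_def by (auto intro!: exI[of _ \<theta>])
    ultimately show ?thesis by blast
  qed (use L in blast)
  \<comment> \<open>The guard \<open>from_nat_into S n \<in> S\<close> covers an empty
    \<open>S\<close>, which occurs when \<open>N\<close> has fewer than two elements.\<close>
  have "\<exists>K. \<forall>n. P (K n) \<and> K (Suc n) \<subseteq> K n \<and> (from_nat_into S n \<in> S \<longrightarrow> cut (from_nat_into S n) (K (Suc n)))"
  proof -
    have "P K0" using K0 pos a b by (simp add: P_def)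
    then have "\<exists>K. \<forall>n. P (K n) \<and> (K (Suc n) \<subseteq> K n \<and> (from_nat_into S n \<in> S \<longrightarrow> cut (from_nat_into S n) (K (Suc n))))"
      using step by (intro dependent_nat_choice[where P = "\<lambda>n. P"]) blast+
    then show ?thesis by blast
  qed
  then obtain K where K: "\<And>n. P (K n)" "\<And>n. K (Suc n) \<subseteq> K n"
    "\<And>n. from_nat_into S n \<in> S \<Longrightarrow> cut (from_nat_into S n) (K (Suc n))" by blast
  show thesis
  proof (rule that[of K])
    fix v w and q r :: real
    assume "v \<in> N" "w \<in> N" "v \<noteq> w" "q \<in> \<rat>" "r \<in> \<rat>"
    then have in_S: "(v, w, q, r) \<in> S" by (simp add: S_def)
    obtain n where "from_nat_into S n = (v, w, q, r)" using from_nat_into_surj[OF \<open>countable S\<close> in_S] by blast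
    then have "cut (v, w, q, r) (K (Suc n))" using K(3)[of n] in_S by simp
    then show "\<exists>n \<theta>. K n \<subseteq> {x. cos \<theta> * (x \<bullet> v - q) + sin \<theta> * (x \<bullet> w - r) \<ge> 0}"
      unfolding cut_def by blast
  qed (use K in \<open>auto simp: P_def\<close>)
qed

section \<open>The bodies have at most a line in common\<close>

lemma span_eq_0_if_orthogonal:
  fixes x :: "'a::euclidean_space"
  assumes "x \<in> span N" "\<And>v. v \<in> N \<Longrightarrow> x \<bullet> v = 0"
  shows "x = 0"
proof -
  have "x \<bullet> y = 0" if "y \<in> span N" for y
    using that assms(2) by (induction rule: span_induct) (auto simp: subspace_def inner_add_right)
  then have "x \<bullet> x = 0" using assms(1) by blast
  then show ?thesis by simp
qed

text \<open>If three points were not collinear, their projections to some plane spanned by \<open>v\<close> and \<open>w\<close>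
  would form a triangle. A line through a rational interior point of the triangle has vertices
  strictly on both sides.\<close>

lemma collinear_if_cut:
  fixes L :: "'a::euclidean_space set"
  assumes span: "\<And>x y. x \<in> L \<Longrightarrow> y \<in> L \<Longrightarrow> x - y \<in> span N"
    and cut: "\<And>v w q r. v \<in> N \<Longrightarrow> w \<in> N \<Longrightarrow> v \<noteq> w \<Longrightarrow> q \<in> \<rat> \<Longrightarrow> r \<in> \<rat> \<Longrightarrow>
      \<exists>\<theta>. L \<subseteq> {x. cos \<theta> * (x \<bullet> v - q) + sin \<theta> * (x \<bullet> w - r) \<ge> 0}"
    and p: "p \<in> L" "p' \<in> L" "p \<noteq> p'" and z: "z \<in> L"
  obtains l where "z = p + l *\<^sub>R (p' - p)"
proof -
  define x y where "x = p' - p" and "y = z - p"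
  have xy: "x \<in> span N" "y \<in> span N" using span p z by (auto simp: x_def y_def)
  obtain v where v: "v \<in> N" "x \<bullet> v \<noteq> 0"
    using span_eq_0_if_orthogonal[OF xy(1)] p(3) by (auto simp: x_def)
  have minor: "(x \<bullet> v) * (y \<bullet> w) - (x \<bullet> w) * (y \<bullet> v) = 0" if w: "w \<in> N" for w
  proof (rule ccontr)
    define D where "D = (x \<bullet> v) * (y \<bullet> w) - (x \<bullet> w) * (y \<bullet> v)"
    assume "(x \<bullet> v) * (y \<bullet> w) - (x \<bullet> w) * (y \<bullet> v) \<noteq> 0"
    then have D: "D \<noteq> 0" "v \<noteq> w" by (auto simp: D_def mult.commute)
    \<comment> \<open>Cramer's rule: \<alpha> and \<beta> are the barycentric coordinates of
      \<open>(q, r)\<close> at the projections of \<open>p'\<close> and \<open>z\<close>, the third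
      vertex being that of \<open>p\<close>. So \<open>?W\<close> is the open triangle, and
      \<open>?c\<close>, its centroid, shows that it is not empty.\<close>
    define \<alpha> where "\<alpha> = (\<lambda>(q, r). ((q - p \<bullet> v) * (y \<bullet> w) - (r - p \<bullet> w) * (y \<bullet> v)) / D)"
    define \<beta> where "\<beta> = (\<lambda>(q, r). ((r - p \<bullet> w) * (x \<bullet> v) - (q - p \<bullet> v) * (x \<bullet> w)) / D)"
    let ?W = "{s. \<alpha> s > 0} \<inter> {s. \<beta> s > 0} \<inter> {s. \<alpha> s + \<beta> s < 1}"
    have "open ?W" unfolding \<alpha>_def \<beta>_def case_prod_unfold
      by (intro open_Int open_Collect_less continuous_intros) (use D in auto)
    moreover have "(p \<bullet> v + (x \<bullet> v + y \<bullet> v) / 3, p \<bullet> w + (x \<bullet> w + y \<bullet> w) / 3) \<in> ?W" (is "?c \<in> _")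
    proof -
      have "(x \<bullet> v + y \<bullet> v) / 3 * (y \<bullet> w) - (x \<bullet> w + y \<bullet> w) / 3 * (y \<bullet> v) = D / 3"
        "(x \<bullet> w + y \<bullet> w) / 3 * (x \<bullet> v) - (x \<bullet> v + y \<bullet> v) / 3 * (x \<bullet> w) = D / 3"
        by (auto simp: D_def field_simps)
      then have "\<alpha> ?c = 1 / 3" "\<beta> ?c = 1 / 3" using D by (auto simp: \<alpha>_def \<beta>_def)
      then show ?thesis by simp
    qed
    ultimately obtain S T where ST: "open S" "open T" "?c \<in> S \<times> T" "S \<times> T \<subseteq> ?W"
      by (rule open_prod_elim)
    have rat: "\<exists>q\<in>\<rat>. q \<in> S" if S: "open S" "s \<in> S" for S and s :: real
    proof -
      obtain e where e: "e > 0" "ball s e \<subseteq> S" using openE[OF S] by blast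
      then obtain q where q: "q \<in> \<rat>" "s < q" "q < s + e"
        using Rats_dense_in_real[of s "s + e"] by auto
      then have "q \<in> ball s e" by (simp add: dist_real_def)
      then show ?thesis using e q by blast
    qed
    obtain q r where qr: "q \<in> \<rat>" "r \<in> \<rat>" "(q, r) \<in> ?W"
    proof -
      obtain q where q: "q \<in> \<rat>" "q \<in> S" using rat[OF ST(1)] ST(3) by auto
      obtain r where r: "r \<in> \<rat>" "r \<in> T" using rat[OF ST(2)] ST(3) by auto
      have "(q, r) \<in> ?W" using q r ST(4) by (intro subsetD[OF ST(4)]) simp
      then show thesis using q r by (intro that)
    qed
    define a b where "a = \<alpha> (q, r)" and "b = \<beta> (q, r)"
    have ab: "a > 0" "b > 0" "a + b < 1" using qr by (auto simp: a_def b_def)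
    have Da: "D * a = (q - p \<bullet> v) * (y \<bullet> w) - (r - p \<bullet> w) * (y \<bullet> v)"
      and Db: "D * b = (r - p \<bullet> w) * (x \<bullet> v) - (q - p \<bullet> v) * (x \<bullet> w)"
      using D(1) by (auto simp: a_def b_def \<alpha>_def \<beta>_def)
    have "D * (p \<bullet> v + a * (x \<bullet> v) + b * (y \<bullet> v))
        = D * (p \<bullet> v) + (D * a) * (x \<bullet> v) + (D * b) * (y \<bullet> v)" by (simp add: algebra_simps)
    also have "\<dots> = D * q" unfolding Da Db by (simp add: D_def algebra_simps)
    finally have "D * (p \<bullet> v + a * (x \<bullet> v) + b * (y \<bullet> v)) = D * q" .
    then have q: "q = p \<bullet> v + a * (x \<bullet> v) + b * (y \<bullet> v)" using D by simp
    have "D * (p \<bullet> w + a * (x \<bullet> w) + b * (y \<bullet> w))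
        = D * (p \<bullet> w) + (D * a) * (x \<bullet> w) + (D * b) * (y \<bullet> w)" by (simp add: algebra_simps)
    also have "\<dots> = D * r" unfolding Da Db by (simp add: D_def algebra_simps)
    finally have "D * (p \<bullet> w + a * (x \<bullet> w) + b * (y \<bullet> w)) = D * r" .
    then have r: "r = p \<bullet> w + a * (x \<bullet> w) + b * (y \<bullet> w)" using D by simp
    obtain \<theta> where \<theta>: "L \<subseteq> {x. cos \<theta> * (x \<bullet> v - q) + sin \<theta> * (x \<bullet> w - r) \<ge> 0}"
      using cut[OF v(1) w D(2) qr(1,2)] by blast
    define X where "X = cos \<theta> * (x \<bullet> v) + sin \<theta> * (x \<bullet> w)"
    define Y where "Y = cos \<theta> * (y \<bullet> v) + sin \<theta> * (y \<bullet> w)"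
    have "0 \<le> - (a * X + b * Y)"
      using subsetD[OF \<theta> p(1)] by (simp add: X_def Y_def q r algebra_simps)
    moreover have "0 \<le> X - (a * X + b * Y)"
      using subsetD[OF \<theta> p(2)] unfolding X_def Y_def q r
      by (simp add: x_def inner_diff_left algebra_simps)
    moreover have "0 \<le> Y - (a * X + b * Y)"
      using subsetD[OF \<theta> z] unfolding X_def Y_def q r
      by (simp add: y_def inner_diff_left algebra_simps)
    \<comment> \<open>\<open>W\<close>, \<open>X + W\<close> and \<open>Y + W\<close> are the values
      of the cutting affine form at \<open>p\<close>, \<open>p'\<close> and \<open>z\<close>. Their
      average with the positive weights \<open>1 - a - b\<close>, \<open>a\<close>, \<open>b\<close>
      is the value at \<open>(q, r)\<close>, which is zero; being nonnegative, all three
      vanish.\<close>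
    moreover define W where "W = - (a * X + b * Y)"
    ultimately have W: "0 \<le> W" "0 \<le> X + W" "0 \<le> Y + W" by auto
    have sum: "(1 - a - b) * W + a * (X + W) + b * (Y + W) = 0" by (simp add: W_def algebra_simps)
    have nn: "0 \<le> (1 - a - b) * W" "0 \<le> a * (X + W)" "0 \<le> b * (Y + W)" using W ab by auto
    have "(1 - a - b) * W = 0" "a * (X + W) = 0" "b * (Y + W) = 0" using sum nn by linarith+
    then have XY: "X = 0" "Y = 0" using ab by auto
    \<comment> \<open>The unit normal would be orthogonal to the projections of \<open>x\<close> and
      \<open>y\<close>, which are independent because \<open>D \<noteq> 0\<close>.\<close>
    have "D * cos \<theta> = (y \<bullet> w) * X - (x \<bullet> w) * Y" "D * sin \<theta> = (x \<bullet> v) * Y - (y \<bullet> v) * X"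
      by (auto simp: D_def X_def Y_def algebra_simps)
    then have "cos \<theta> = 0" "sin \<theta> = 0" using XY D by auto
    then show False using sin_cos_squared_add[of \<theta>] by simp
  qed
  define l where "l = (y \<bullet> v) / (x \<bullet> v)"
  have "y - l *\<^sub>R x = 0"
  proof (rule span_eq_0_if_orthogonal)
    show "y - l *\<^sub>R x \<in> span N" using xy by (intro span_diff span_scale)
    show "(y - l *\<^sub>R x) \<bullet> w = 0" if "w \<in> N" for w
      using minor[OF that] v(2) by (simp add: l_def inner_diff_left field_simps)
  qed
  then have "z = p + l *\<^sub>R (p' - p)" by (simp add: x_def y_def algebra_simps)
  then show thesis by (rule that)
qed

section \<open>Neighbourhoods of compact sets\<close>

lemma compact_nest_subset_open:
  fixes C :: "nat \<Rightarrow> 'a::heine_borel set"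
  assumes C: "\<And>n. compact (C n)" "\<And>n. C (Suc n) \<subseteq> C n" and W: "open W" "(\<Inter>n. C n) \<subseteq> W"
  obtains n where "C n \<subseteq> W"
proof (rule ccontr)
  assume "\<not> thesis"
  then have ne: "C n - W \<noteq> {}" for n using that by blast
  have mono: "C n \<subseteq> C m" if "m \<le> n" for m n using lift_Suc_antimono_le[of C, OF C(2)] that by blast
  have "\<Inter>(range (\<lambda>n. C n - W)) \<noteq> {}"
  proof (rule compact_nest)
    show "C n - W \<subseteq> C m - W" if "m \<le> n" for m n using mono[OF that] by blast
  qed (use C(1) W(1) ne in \<open>auto intro: compact_diff\<close>)
  then show False using W(2) by auto
qed

text \<open>The gain from \<delta> to \<delta>' pays for thickening \<open>F\<close> and for moving
  the base point from \<open>r'\<close> to \<open>r\<close>. Short segments meet no point of the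
  thickened set, as \<open>F\<close> keeps a distance \<rho> from \<open>B\<close>. On segments of
  length at least \<open>\<rho> / 2\<close> a fixed additive error is absorbed by the larger
  slope.\<close>

lemma thin_neighborhood:
  fixes F B :: "real set"
  assumes F: "compact F" and B: "compact B" and dis: "F \<inter> B = {}" and \<delta>: "0 \<le> \<delta>" "\<delta> < \<delta>'" "\<delta>' \<le> 1"
    and thin: "\<And>r t. r \<in> B \<Longrightarrow> measure lborel (F \<inter> closed_segment r t) \<le> \<delta> * \<bar>t - r\<bar>"
  obtains \<epsilon> where "\<epsilon> > 0" "\<And>r' r t. r' \<in> B \<Longrightarrow> \<bar>r - r'\<bar> < \<epsilon> \<Longrightarrow>
    measure lborel ((\<Union>y\<in>F. ball y (2 * \<epsilon>)) \<inter> closed_segment r t) \<le> \<delta>' * \<bar>t - r\<bar>"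
proof -
  have [measurable]: "F \<in> sets borel" using F compact_imp_closed borel_closed by blast
  obtain \<rho> where \<rho>: "\<rho> > 0" "\<And>x y. x \<in> F \<Longrightarrow> y \<in> B \<Longrightarrow> \<rho> \<le> dist x y"
    using separate_compact_closed[OF F compact_imp_closed[OF B] dis] by blast
  \<comment> \<open>The additive error below is at most
    \<open>2 * \<epsilon> + \<eta> \<le> 2 * \<eta>\<close>, and
    \<open>2 * \<eta> = (\<delta>' - \<delta>) * (\<rho> / 2)\<close>.\<close>
  define \<eta> where "\<eta> = (\<delta>' - \<delta>) * \<rho> / 4"
  have \<eta>: "\<eta> > 0" using \<rho> \<delta> by (simp add: \<eta>_def)
  have fm: "F \<in> fmeasurable lborel" using F by (intro fmeasurable_compact) 
  obtain Q where Q: "open Q" "F \<subseteq> Q" "emeasure lborel (Q - F) < ennreal \<eta>"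
    using outer_regular_lborel[of F \<eta>] \<eta> by auto
  obtain \<epsilon>1 where \<epsilon>1: "\<epsilon>1 > 0" "(\<Union>x\<in>F. ball x \<epsilon>1) \<subseteq> Q"
    using compact_subset_open_imp_ball_epsilon_subset[OF F Q(1,2)] by blast
  \<comment> \<open>The three bounds keep \<open>U\<close> inside \<open>Q\<close>, make
    \<open>3 * \<epsilon> + \<rho> / 2 \<le> \<rho>\<close> for short segments, and give
    \<open>2 * \<epsilon> \<le> \<eta>\<close> for long ones.\<close>
  define \<epsilon> where "\<epsilon> = min (\<epsilon>1 / 2) (min (\<rho> / 6) (\<eta> / 2))"
  have \<epsilon>: "\<epsilon> > 0" "2 * \<epsilon> \<le> \<epsilon>1" "6 * \<epsilon> \<le> \<rho>" "2 * \<epsilon> \<le> \<eta>"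
    using \<epsilon>1 \<rho> \<eta> by (auto simp: \<epsilon>_def)
  define U where "U = (\<Union>y\<in>F. ball y (2 * \<epsilon>))"
  have UQ: "U \<subseteq> Q" using \<epsilon>1(2) \<epsilon>(2) unfolding U_def by (fastforce simp: subset_eq)
  have "open U" unfolding U_def by blast
  then have [measurable]: "U \<in> sets borel" "Q \<in> sets borel" using Q by auto
  have seg: "closed_segment x y \<in> fmeasurable lborel" for x y :: real
    by (intro fmeasurable_compact) auto
  have "measure lborel (U \<inter> closed_segment r t) \<le> \<delta>' * \<bar>t - r\<bar>"
    if r': "r' \<in> B" and r: "\<bar>r - r'\<bar> < \<epsilon>" for r' r t
  proof (cases "\<bar>t - r\<bar> < \<rho> / 2")
    case True
    have "U \<inter> closed_segment r t = {}"
    proof (rule ccontr)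
      assume "U \<inter> closed_segment r t \<noteq> {}"
      then obtain y z where y: "y \<in> F" and yz: "\<bar>y - z\<bar> < 2 * \<epsilon>" and z: "z \<in> closed_segment r t"
        by (auto simp: U_def dist_real_def)
      have "\<bar>z - r\<bar> \<le> \<bar>t - r\<bar>" using z by (auto simp: closed_segment_eq_real_ivl split: if_splits)
      then show False using \<rho>(2)[OF y r', unfolded dist_real_def] yz r True \<epsilon>(3) by linarith
    qed
    then show ?thesis using \<delta> by simp
  next
    case False
    have "U \<inter> closed_segment r t \<subseteq> (F \<inter> closed_segment r' t) \<union> closed_segment r' r \<union> (Q - F)"
      using UQ by (auto simp: closed_segment_eq_real_ivl split: if_splits)
    moreover have QF: "Q - F \<in> fmeasurable lborel" using Q(3) by (intro fmeasurableI) (auto intro: less_trans)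
    moreover have "F \<inter> closed_segment r' t \<in> fmeasurable lborel"
      using seg by (rule fmeasurableI2) auto
    ultimately have "measure lborel (U \<inter> closed_segment r t)
        \<le> measure lborel ((F \<inter> closed_segment r' t) \<union> closed_segment r' r \<union> (Q - F))"
      using seg by (intro measure_mono_fmeasurable fmeasurable.Un) auto
    also have "\<dots> \<le> measure lborel (F \<inter> closed_segment r' t) + measure lborel (closed_segment r' r) + measure lborel (Q - F)"
      by (intro order_trans[OF measure_Un_le] add_right_mono measure_Un_le) auto
    also have "measure lborel (F \<inter> closed_segment r' t) \<le> \<delta> * \<bar>t - r'\<bar>" by (rule thin[OF r'])
    also have "measure lborel (closed_segment r' r) \<le> \<epsilon>"
      using r by (auto simp: closed_segment_eq_real_ivl)
    also have "measure lborel (Q - F) \<le> \<eta>"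
      using Q(3) QF \<eta> by (simp add: emeasure_eq_measure2 ennreal_less_iff)
    also have "\<delta> * \<bar>t - r'\<bar> \<le> \<delta> * (\<bar>t - r\<bar> + \<epsilon>)" using r \<delta> by (intro mult_left_mono) auto
    also have "\<dots> \<le> \<delta> * \<bar>t - r\<bar> + \<epsilon>" using \<delta> \<epsilon>(1) by (simp add: algebra_simps mult_left_le_one_le)
    also have "\<delta> * \<bar>t - r\<bar> + \<epsilon> + \<epsilon> + \<eta> \<le> \<delta> * \<bar>t - r\<bar> + (\<delta>' - \<delta>) * (\<rho> / 2)"
    proof -
      have "2 * \<eta> = (\<delta>' - \<delta>) * (\<rho> / 2)" by (simp add: \<eta>_def)
      then show ?thesis using \<epsilon>(4) by linarith
    qed
    also have "\<dots> \<le> \<delta> * \<bar>t - r\<bar> + (\<delta>' - \<delta>) * \<bar>t - r\<bar>"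
      using False \<delta> by (intro add_left_mono mult_left_mono) auto
    also have "\<dots> = \<delta>' * \<bar>t - r\<bar>" by (simp add: algebra_simps)
    finally show ?thesis by simp
  qed
  then show thesis using that[OF \<epsilon>(1)] unfolding U_def by blast
qed

lemma measure_lborel_isometry:
  fixes S :: "real set"
  assumes S: "S \<in> sets borel" and \<sigma>: "\<bar>\<sigma>\<bar> = 1"
  shows "measure lborel {y. c + \<sigma> * y \<in> S} = measure lborel S"
proof -
  have plus: "measure lborel ((+) c -` S) = measure lborel S"
  proof -
    have "measure (distr lborel borel ((+) c)) S = measure lborel ((+) c -` S \<inter> space lborel)"
      using S by (intro measure_distr) auto
    then show ?thesis by (simp add: lborel_distr_plus)
  qed
  have plusm: "(+) c -` S \<in> sets borel"
    using measurable_sets[of "(+) c" borel borel S] S by simp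
  consider "\<sigma> = 1" | "\<sigma> = -1" using \<sigma> by linarith
  then show ?thesis
  proof cases
    case 1
    then have "{y. c + \<sigma> * y \<in> S} = (+) c -` S" by auto
    then show ?thesis using plus by simp
  next
    case 2
    then have "{y. c + \<sigma> * y \<in> S} = uminus -` ((+) c -` S)" by auto
    then show ?thesis using plus measure_lborel_uminus[OF plusm] by metis
  qed
qed

section \<open>Localization to a segment\<close>

lemma power_mean_mono:
  assumes "0 \<le> \<alpha>" "\<alpha> \<le> 1" "0 < x" "x \<le> x'" "0 < y"
  shows "power_mean s \<alpha> x y \<le> power_mean s \<alpha> x' y"
proof -
  have "\<alpha> * box_cox s x \<le> \<alpha> * box_cox s x'"
    using assms box_cox_le_iff[of x x' s] by (intro mult_left_mono) auto
  then show ?thesis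
    using assms by (subst power_mean_le_iff) (auto simp: power_mean_pos box_cox_power_mean)
qed

text \<open>The intersection \<open>J\<close> of the bodies meets both \<open>B\<close> and the
  complement of \<open>A\<close>, so it has two distinct points and determines a direction
  \<open>e\<close>. For a body close to \<open>J\<close>, the projection to \<open>e\<close>
  satisfies the hypotheses of \<open>real_power_mean_le\<close> with \<delta>'. The proportions kept
  by the bisection then turn its conclusion into \<open>power_mean s \<delta>' b 1 \<le> a\<close>,
  against the choice of \<delta>'.\<close>

theorem convex_body_power_mean_le:
  fixes M :: "'a::euclidean_space measure"
  assumes fin: "finite_measure M" and sets: "sets M = sets borel" and sc: "s_concave s M" and s: "s \<le> 1"
    and K: "compact K" "convex K" and A: "open A" and B: "compact B" "B \<subseteq> A"
    and \<delta>: "0 \<le> \<delta>" "\<delta> < 1"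
    and thin: "\<And>x v T. x \<in> B \<Longrightarrow> norm v = 1 \<Longrightarrow> 0 \<le> T \<Longrightarrow>
      measure lborel {\<tau> \<in> {0..T}. x + \<tau> *\<^sub>R v \<notin> A} \<le> \<delta> * T"
    and pos: "measure M (K \<inter> B) > 0"
  shows "power_mean s \<delta> (measure M (K \<inter> B)) (measure M K) \<le> measure M (K \<inter> A)"
proof (rule ccontr)
  assume neg: "\<not> ?thesis"
  interpret finite_measure M by fact
  have [simp]: "S \<in> sets M" if "S \<in> sets borel" for S using that sets by simp
  have Bm: "B \<in> sets borel" using B(1) compact_imp_closed borel_closed by blast
  have Am: "A \<in> sets borel" using A by simp
  have Kb: "L \<in> sets borel" if "compact L" for L :: "'a set"
    using that compact_imp_closed borel_closed by blast
  obtain V K0 where V: "subspace V" and K0: "K0 \<subseteq> K" "compact K0" "convex K0" "measure M (K - K0) = 0"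
    and diff_V: "\<And>x y. x \<in> K0 \<Longrightarrow> y \<in> K0 \<Longrightarrow> x - y \<in> V"
    and null: "\<And>v c. v \<in> V \<Longrightarrow> v \<noteq> 0 \<Longrightarrow> measure M (K0 \<inter> {x. x \<bullet> v = c}) = 0"
    using essential_subspace[OF fin sets sc K] by metis
  have K0_eq: "measure M (K0 \<inter> S) = measure M (K \<inter> S)" if "S \<in> sets borel" for S
  proof -
    have "measure M (K \<inter> S - K0 \<inter> S) \<le> measure M (K - K0)"
      using K K0 Kb by (intro finite_measure_mono) auto
    then have "measure M (K \<inter> S - K0 \<inter> S) = 0"
      using K0(4) measure_nonneg[of M "K \<inter> S - K0 \<inter> S"] by linarith
    moreover have "measure M (K \<inter> S - K0 \<inter> S) = measure M (K \<inter> S) - measure M (K0 \<inter> S)"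
      using K K0 Kb that by (intro finite_measure_Diff) auto
    ultimately show ?thesis by simp
  qed
  define k where "k = measure M K0"
  have k_eq: "k = measure M K" using K0_eq[of UNIV] by (simp add: k_def)
  have "measure M (K \<inter> B) \<le> measure M K" using Bm Kb[OF K(1)] by (intro finite_measure_mono) auto
  then have k: "k > 0" using pos k_eq by simp
  define b a where "b = measure M (K0 \<inter> B) / k" and "a = measure M (K0 \<inter> A) / k"
  have b: "b > 0" "b \<le> 1"
    using pos k \<open>measure M (K \<inter> B) \<le> measure M K\<close> k_eq by (auto simp: b_def K0_eq Bm)
  have "k * power_mean s \<delta> b 1 = power_mean s \<delta> (k * b) (k * 1)"
    using \<delta> b k by (intro power_mean_scale[symmetric]) auto
  also have "\<dots> = power_mean s \<delta> (measure M (K \<inter> B)) (measure M K)"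
    using k by (simp add: b_def K0_eq Bm k_eq)
  finally have ab: "a < power_mean s \<delta> b 1"
    using neg k by (simp add: a_def K0_eq Am field_simps)
  have "((\<lambda>\<delta>'. power_mean s \<delta>' b 1) \<longlongrightarrow> power_mean s \<delta> b 1) (at_right \<delta>)"
    using \<delta> b by (intro tendsto_power_mean tendsto_intros) auto
  then have "eventually (\<lambda>\<delta>'. a < power_mean s \<delta>' b 1) (at_right \<delta>)"
    using ab by (rule order_tendstoD(1))
  moreover have "eventually (\<lambda>\<delta>'. \<delta>' \<in> {\<delta><..<1}) (at_right \<delta>)"
    using \<delta> by (intro eventually_at_right_real) auto
  ultimately have "eventually (\<lambda>\<delta>'. a < power_mean s \<delta>' b 1 \<and> \<delta>' \<in> {\<delta><..<1}) (at_right \<delta>)"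
    by (rule eventually_conj)
  from eventually_happens'[OF trivial_limit_at_right_real this]
  obtain \<delta>' where \<delta>': "\<delta> < \<delta>'" "\<delta>' < 1" "a < power_mean s \<delta>' b 1" by auto
  obtain N where N: "pairwise orthogonal N" "\<And>v. v \<in> N \<Longrightarrow> norm v = 1" "independent N" "span N = V"
    using orthonormal_basis_subspace[OF V] by metis
  have NV: "v \<in> V" if "v \<in> N" for v using that N(4) span_base by blast
  have nullN: "measure M (K0 \<inter> {x. x \<bullet> (cos \<theta> *\<^sub>R v + sin \<theta> *\<^sub>R w) = c}) = 0"
    if vw: "v \<in> N" "w \<in> N" "v \<noteq> w" for v w \<theta> c
  proof (rule null)
    let ?u = "cos \<theta> *\<^sub>R v + sin \<theta> *\<^sub>R w"
    show "?u \<in> V" using V vw NV by (auto intro: subspace_add subspace_scale)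
    have "v \<bullet> w = 0" using N(1) vw by (auto simp: pairwise_def orthogonal_def)
    moreover have "v \<bullet> v = 1" "w \<bullet> w = 1" using N(2) vw by (auto simp: norm_eq_1)
    ultimately have "?u \<bullet> ?u = (cos \<theta>)\<^sup>2 + (sin \<theta>)\<^sup>2"
      by (simp add: inner_add_left inner_add_right inner_commute power2_eq_square)
    then show "?u \<noteq> 0" by auto
  qed
  have Kprops: "measure M K0 > 0" "measure M (K0 \<inter> B) = b * measure M K0" "measure M (K0 \<inter> A) \<le> a * measure M K0"
    using k by (auto simp: b_def a_def simp flip: k_def)
  obtain L :: "nat \<Rightarrow> 'a set" where L: "\<And>n. compact (L n)" "\<And>n. convex (L n)" "\<And>n. L n \<subseteq> K0"
    "\<And>n. L (Suc n) \<subseteq> L n" "\<And>n. measure M (L n) > 0" "\<And>n. measure M (L n \<inter> B) = b * measure M (L n)"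
    "\<And>n. measure M (L n \<inter> A) \<le> a * measure M (L n)"
    and cuts: "\<And>v w q r. v \<in> N \<Longrightarrow> w \<in> N \<Longrightarrow> v \<noteq> w \<Longrightarrow> q \<in> \<rat> \<Longrightarrow> r \<in> \<rat> \<Longrightarrow>
      \<exists>n \<theta>. L n \<subseteq> {x. cos \<theta> * (x \<bullet> v - q) + sin \<theta> * (x \<bullet> w - r) \<ge> 0}"
    by (rule bisection_sequence[OF fin sets K0(2,3) Am Bm countable_finite[OF independent_imp_finite[OF N(3)]] nullN Kprops], assumption+, rule that)
  have Lmono: "L n \<subseteq> L m" if "m \<le> n" for m n using lift_Suc_antimono_le[of L, OF L(4)] that by blast
  define J where "J = (\<Inter>n. L n)"
  have Jsub: "J \<subseteq> L n" for n by (auto simp: J_def)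
  have "closed J" unfolding J_def using L(1) by (intro closed_INT) (auto intro: compact_imp_closed)
  then have J: "compact J" using compact_Int_closed[OF L(1)[of 0], of J] Jsub[of 0] by (simp add: Int_absorb1)
  have pm1: "power_mean s \<delta>' b 1 \<le> 1" using power_mean_upper[of \<delta>' b 1 s] \<delta> \<delta>' b by simp
  \<comment> \<open>A body inside \<open>A\<close> would contain \<open>A\<close> in proportion one,
    above \<open>a\<close>; a body that misses \<open>B\<close> would contradict
    \<open>b > 0\<close>.\<close>
  have "\<not> J \<subseteq> A"
  proof
    assume "J \<subseteq> A"
    then obtain n where "L n \<subseteq> A"
      using compact_nest_subset_open[of L A] L(1,4) A unfolding J_def by metis
    then have "L n \<inter> A = L n" by auto
    then have "measure M (L n) \<le> a * measure M (L n)" using L(7)[of n] by simp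
    then show False using L(5)[of n] \<delta>'(3) pm1 by simp
  qed
  then obtain z where z: "z \<in> J" "z \<notin> A" by auto
  have "J \<inter> B \<noteq> {}"
  proof
    assume "J \<inter> B = {}"
    moreover have "open (- B)" using B(1) compact_imp_closed by auto
    ultimately obtain n where "L n \<subseteq> - B"
      using compact_nest_subset_open[of L "- B"] L(1,4) unfolding J_def by blast
    then have "L n \<inter> B = {}" by auto
    then show False using L(6)[of n] L(5)[of n] b by simp
  qed
  then obtain p where p: "p \<in> J" "p \<in> B" by auto
  have pz: "p \<noteq> z" using p z B(2) by auto
  define e where "e = (z - p) /\<^sub>R norm (z - p)"
  have e1: "norm e = 1" using pz by (simp add: e_def)
  then have ee: "e \<bullet> e = 1" by (simp add: norm_eq_1)
  have JK0: "J \<subseteq> K0" using Jsub L(3) by blast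
  \<comment> \<open>Membership in \<open>V\<close> makes the hyperplanes orthogonal to
    \<open>e\<close> null, so the projected measures have no atoms.\<close>
  have eV: "e \<in> V" unfolding e_def using V diff_V z p JK0 by (auto intro: subspace_scale)
  have on_line: "\<exists>l. x = p + l *\<^sub>R (z - p)" if x: "x \<in> J" for x
  proof (rule collinear_if_cut[of J N p z x])
    show "x - y \<in> span N" if "x \<in> J" "y \<in> J" for x y using that diff_V JK0 N(4) by blast
    show "\<exists>\<theta>. J \<subseteq> {x. cos \<theta> * (x \<bullet> v - q) + sin \<theta> * (x \<bullet> w - r) \<ge> 0}"
      if "v \<in> N" "w \<in> N" "v \<noteq> w" "q \<in> \<rat>" "r \<in> \<rat>" for v w q r
      using cuts[OF that] Jsub by (meson order_trans)
  qed (use p z pz x in auto)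
  define X where "X x = x \<bullet> e" for x
  have line: "y = x + (X y - X x) *\<^sub>R e" if xy: "x \<in> J" "y \<in> J" for x y
  proof -
    obtain l m where l: "x = p + l *\<^sub>R (z - p)" and m: "y = p + m *\<^sub>R (z - p)"
      using on_line xy by meson
    have zp: "z - p = norm (z - p) *\<^sub>R e" using pz by (simp add: e_def)
    define d where "d = norm (z - p)"
    have x: "x = p + (l * d) *\<^sub>R e" and y: "y = p + (m * d) *\<^sub>R e"
      using l m zp unfolding d_def by (metis scaleR_scaleR)+
    have "X y - X x = m * d - l * d" unfolding X_def x y by (simp add: inner_add_left ee)
    moreover have "y = x + (m * d - l * d) *\<^sub>R e" unfolding x y by (simp add: algebra_simps)
    ultimately show ?thesis by simp
  qed
  have linX: "linear X" unfolding X_def by (intro linearI) (auto simp: inner_add_left)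
  have contX: "continuous_on S X" for S unfolding X_def by (intro continuous_intros)
  have Xm: "X \<in> borel_measurable borel" using contX by (rule borel_measurable_continuous_onI)
  define F C where "F = X ` (J - A)" and "C = X ` (J \<inter> B)"
  have F: "compact F" unfolding F_def using J A by (intro compact_continuous_image contX compact_diff)
  have C: "compact C" unfolding C_def using J B(1) by (intro compact_continuous_image contX compact_Int)
  have dis: "F \<inter> C = {}"
  proof (rule ccontr)
    assume "F \<inter> C \<noteq> {}"
    then obtain x y where xy: "x \<in> J - A" "y \<in> J \<inter> B" "X x = X y" by (auto simp: F_def C_def)
    then have "y = x" using line[of x y] by simp
    then show False using xy B(2) by auto
  qed
  have thinF: "measure lborel (F \<inter> closed_segment r t) \<le> \<delta> * \<bar>t - r\<bar>" if r: "r \<in> C" for r t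
  proof -
    obtain x where x: "x \<in> J" "x \<in> B" "r = X x" using r by (auto simp: C_def)
    \<comment> \<open>The assumption \<open>thin\<close> is about rays with
      \<open>T \<ge> 0\<close>, so the direction carries the sign of \<open>t - r\<close>.\<close>
    define \<sigma> :: real where "\<sigma> = (if r \<le> t then 1 else -1)"
    have \<sigma>: "\<bar>\<sigma>\<bar> = 1" "\<sigma> * \<sigma> = 1" by (auto simp: \<sigma>_def)
    let ?T = "{\<tau> \<in> {0..\<bar>t - r\<bar>}. x + \<tau> *\<^sub>R (\<sigma> *\<^sub>R e) \<notin> A}"
    have "?T = {0..\<bar>t - r\<bar>} \<inter> (\<lambda>\<tau>. x + \<tau> *\<^sub>R (\<sigma> *\<^sub>R e)) -` (- A)" by auto
    moreover have "closed ((\<lambda>\<tau>. x + \<tau> *\<^sub>R (\<sigma> *\<^sub>R e)) -` (- A))"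
      using A by (intro closed_vimage continuous_intros) auto
    ultimately have Tm: "compact ?T" by (simp add: compact_Int_closed)
    have Tb: "?T \<in> sets borel" using Tm compact_imp_closed borel_closed by blast
    let ?T' = "{y. - (\<sigma> * r) + \<sigma> * y \<in> ?T}"
    have sub: "F \<inter> closed_segment r t \<subseteq> ?T'"
    proof
      fix y assume y: "y \<in> F \<inter> closed_segment r t"
      then obtain x' where x': "x' \<in> J" "x' \<notin> A" "y = X x'" by (auto simp: F_def)
      have "x' = x + (y - r) *\<^sub>R e" using line[OF x(1) x'(1)] x x' by simp
      also have "y - r = (\<sigma> * (y - r)) * \<sigma>" using \<sigma> by (simp add: mult_ac flip: mult.assoc)
      finally have "x + (\<sigma> * (y - r)) *\<^sub>R (\<sigma> *\<^sub>R e) \<notin> A" using x'(2) by simp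
      moreover have "\<sigma> * (y - r) \<in> {0..\<bar>t - r\<bar>}"
        using y by (auto simp: \<sigma>_def closed_segment_eq_real_ivl split: if_splits)
      moreover have "- (\<sigma> * r) + \<sigma> * y = \<sigma> * (y - r)" by (simp add: algebra_simps)
      ultimately show "y \<in> ?T'" by simp
    qed
    have T'm: "?T' \<in> sets borel" using Tb by measurable
    have eT: "measure lborel ?T' = measure lborel ?T" using Tb \<sigma>(1) by (rule measure_lborel_isometry)
    have sub': "?T' \<subseteq> closed_segment r t"
    proof
      fix y assume "y \<in> ?T'"
      then have "- (\<sigma> * r) + \<sigma> * y \<in> {0..\<bar>t - r\<bar>}" by simp
      then show "y \<in> closed_segment r t"
        by (auto simp: \<sigma>_def closed_segment_eq_real_ivl split: if_splits)
    qed
    have Fm: "F \<inter> closed_segment r t \<in> sets lborel"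
      using compact_imp_closed[OF F] by (simp add: borel_closed closed_Int)
    have "closed_segment r t \<in> fmeasurable lborel" by (intro fmeasurable_compact) auto
    moreover have "?T' \<in> sets lborel" using T'm by (simp only: sets_lborel)
    ultimately have "?T' \<in> fmeasurable lborel" using sub' fmeasurableI2 by blast
    with sub Fm have "measure lborel (F \<inter> closed_segment r t) \<le> measure lborel ?T'"
      by (rule measure_mono_fmeasurable)
    also have "\<dots> \<le> \<delta> * \<bar>t - r\<bar>"
      unfolding eT using x e1 \<sigma> by (intro thin) auto
    finally show ?thesis .
  qed
  obtain \<epsilon> where \<epsilon>: "\<epsilon> > 0" and thin\<epsilon>: "\<And>r' r t. r' \<in> C \<Longrightarrow> \<bar>r - r'\<bar> < \<epsilon> \<Longrightarrow>
    measure lborel ((\<Union>y\<in>F. ball y (2 * \<epsilon>)) \<inter> closed_segment r t) \<le> \<delta>' * \<bar>t - r\<bar>"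
    using thin_neighborhood[OF F C dis \<delta>(1) \<delta>'(1) _ thinF] \<delta>'(2) by (metis less_eq_real_def)
  define U where "U = (\<Union>y\<in>F. ball y (2 * \<epsilon>))"
  \<comment> \<open>The compact sets \<open>L n \<inter> S\<close> decrease to
    \<open>J \<inter> S\<close>, so their projections end up \<epsilon>-close to that of
    \<open>J \<inter> S\<close>. This is applied to the complement of \<open>A\<close> and to
    \<open>B\<close>.\<close>
  have near: "\<exists>n. L n \<inter> S \<subseteq> X -` (\<Union>y\<in>X ` (J \<inter> S). ball y \<epsilon>)" if S: "closed S" for S
  proof -
    have "open (X -` (\<Union>y\<in>X ` (J \<inter> S). ball y \<epsilon>))"
      using contX[of UNIV] by (intro open_vimage) auto
    moreover have "(\<Inter>n. L n \<inter> S) \<subseteq> X -` (\<Union>y\<in>X ` (J \<inter> S). ball y \<epsilon>)"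
    proof
      fix x assume "x \<in> (\<Inter>n. L n \<inter> S)"
      then have "X x \<in> X ` (J \<inter> S)" by (auto simp: J_def)
      moreover have "X x \<in> ball (X x) \<epsilon>" using \<epsilon> by simp
      ultimately show "x \<in> X -` (\<Union>y\<in>X ` (J \<inter> S). ball y \<epsilon>)" by blast
    qed
    moreover have "compact (L n \<inter> S)" for n using L(1) S by (intro compact_Int_closed)
    moreover have "L (Suc n) \<inter> S \<subseteq> L n \<inter> S" for n using L(4) by blast
    ultimately show ?thesis using compact_nest_subset_open[of "\<lambda>n. L n \<inter> S"] by metis
  qed
  obtain n1 where n1: "L n1 \<inter> (- A) \<subseteq> X -` (\<Union>y\<in>X ` (J \<inter> (- A)). ball y \<epsilon>)" using near[of "- A"] A by auto
  obtain n2 where n2: "L n2 \<inter> B \<subseteq> X -` (\<Union>y\<in>X ` (J \<inter> B). ball y \<epsilon>)"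
    using near[of B] B(1) compact_imp_closed by blast
  define n where "n = max n1 n2"
  have Ln: "L n \<subseteq> L n1" "L n \<subseteq> L n2" using Lmono by (auto simp: n_def)
  have Lnm: "L n \<in> sets borel" using Kb L(1) by blast
  \<comment> \<open>The preimage of \<open>Cn\<close> may exceed \<open>B\<close>, while the
    preimage of the complement of \<open>Fn\<close> lies in \<open>A\<close>. Both errors go the
    right way, the mean being increasing in its first argument.\<close>
  define Fn Cn where "Fn = X ` (L n - A)" and "Cn = X ` (L n \<inter> B)"
  have Fn: "compact Fn" unfolding Fn_def using L(1) A by (intro compact_continuous_image contX compact_diff)
  have Cn: "compact Cn" unfolding Cn_def using L(1) B(1) by (intro compact_continuous_image contX compact_Int)
  have FnF: "\<exists>y'\<in>F. \<bar>y - y'\<bar> < \<epsilon>" if "y \<in> Fn" for y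
    using that n1 Ln(1) unfolding Fn_def F_def
    by (fastforce simp: dist_real_def abs_minus_commute Diff_eq)
  have CnC: "\<exists>r'\<in>C. \<bar>r - r'\<bar> < \<epsilon>" if "r \<in> Cn" for r
    using that n2 Ln(2) unfolding Cn_def C_def
    by (fastforce simp: dist_real_def abs_minus_commute)
  let ?\<nu> = "distr (restrict_space M (L n)) borel X"
  have m: "measure ?\<nu> S = measure M (L n \<inter> X -` S)" if "S \<in> sets borel" for S
    using sets Xm Lnm that by (rule measure_distr_restrict)
  obtain p' q' where pq: "X ` L n \<subseteq> {p'..q'}"
  proof -
    have "bounded (X ` L n)" using L(1) by (intro compact_imp_bounded compact_continuous_image contX)
    then obtain c where "\<And>y. y \<in> X ` L n \<Longrightarrow> norm y \<le> c" unfolding bounded_iff by blast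
    then have "X ` L n \<subseteq> {-c..c}" by (force simp: abs_le_iff)
    then show thesis by (rule that)
  qed
  have Cnm: "Cn \<in> sets borel" "Fn \<in> sets borel" using Cn Fn compact_imp_closed borel_closed by blast+
  have \<nu>C: "b * measure M (L n) \<le> measure ?\<nu> Cn"
    unfolding L(6)[symmetric] m[OF Cnm(1)]
  proof (rule finite_measure_mono)
    show "L n \<inter> B \<subseteq> L n \<inter> X -` Cn" by (auto simp: Cn_def)
    show "L n \<inter> X -` Cn \<in> sets M" using Lnm measurable_sets[OF Xm Cnm(1)] by simp
  qed
  have bL: "b * measure M (L n) > 0" using b L(5) by simp
  have "power_mean s \<delta>' (measure ?\<nu> Cn) (measure ?\<nu> UNIV) \<le> measure ?\<nu> (- Fn)"
  proof (rule real_power_mean_le)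
    show "finite_measure ?\<nu>" using fin sets Xm Lnm by (rule finite_measure_distr_restrict)
    show "s_concave s ?\<nu>" using fin sets sc linX L(1,2) by (rule s_concave_distr_restrict)
    have "L n \<inter> X -` (- {p'..q'}) = {}" using pq by auto
    then show "measure ?\<nu> (- {p'..q'}) = 0" by (simp add: m)
    show "measure ?\<nu> {x} = 0" for x
    proof -
      have "measure M (L n \<inter> X -` {x}) \<le> measure M (K0 \<inter> {y. y \<bullet> e = x})"
      proof (rule finite_measure_mono)
        have "closed {y. y \<bullet> e = x}" by (intro closed_Collect_eq continuous_intros)
        then show "K0 \<inter> {y. y \<bullet> e = x} \<in> sets M" using Kb[OF K0(2)] by simp
      qed (use L(3) in \<open>auto simp: X_def\<close>)
      also have "\<dots> = 0" using eV e1 by (intro null) auto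
      finally show ?thesis using measure_nonneg[of M "L n \<inter> X -` {x}"] by (simp add: m)
    qed
    show "U \<in> sets borel" unfolding U_def by (intro borel_open) auto
    \<comment> \<open>\<open>Fn\<close> is within \<epsilon> of \<open>F\<close>, and a further
      \<open>\<epsilon> / 2\<close> stays below the radius \<open>2 * \<epsilon>\<close> of
      \<open>U\<close>.\<close>
    show "\<epsilon> / 2 > 0" using \<epsilon> by simp
    show "{y - \<epsilon> / 2..y + \<epsilon> / 2} \<subseteq> U" if y: "y \<in> Fn" for y
    proof -
      obtain y' where "y' \<in> F" "\<bar>y - y'\<bar> < \<epsilon>" using FnF[OF y] by blast
      then have "{y - \<epsilon> / 2..y + \<epsilon> / 2} \<subseteq> ball y' (2 * \<epsilon>)"
        by (auto simp: dist_real_def)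
      then show ?thesis using \<open>y' \<in> F\<close> unfolding U_def by blast
    qed
    show "measure lborel (U \<inter> {x..r}) \<le> \<delta>' * (r - x)" if r: "r \<in> Cn" "x \<le> r" for r x
    proof -
      obtain r' where "r' \<in> C" "\<bar>r - r'\<bar> < \<epsilon>" using CnC[OF r(1)] by blast
      then show ?thesis using thin\<epsilon>[of r' r x] r(2) by (simp add: U_def closed_segment_eq_real_ivl)
        (cases "x = r"; simp)
    qed
    show "measure lborel (U \<inter> {r..x}) \<le> \<delta>' * (x - r)" if r: "r \<in> Cn" "r \<le> x" for r x
    proof -
      obtain r' where "r' \<in> C" "\<bar>r - r'\<bar> < \<epsilon>" using CnC[OF r(1)] by blast
      then show ?thesis using thin\<epsilon>[of r' r x] r(2) by (simp add: U_def closed_segment_eq_real_ivl)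
    qed
    show "measure ?\<nu> Cn > 0" using \<nu>C bL by linarith
  qed (use s Fn Cn \<delta> \<delta>' in auto)
  also have "measure ?\<nu> (- Fn) \<le> measure M (L n \<inter> A)"
  proof -
    have "L n \<inter> X -` (- Fn) \<subseteq> L n \<inter> A" by (auto simp: Fn_def)
    then have "measure M (L n \<inter> X -` (- Fn)) \<le> measure M (L n \<inter> A)"
      using Lnm Am by (intro finite_measure_mono) auto
    then show ?thesis using Cnm by (simp add: m)
  qed
  also have "\<dots> \<le> a * measure M (L n)" by (rule L(7))
  finally have "power_mean s \<delta>' (measure ?\<nu> Cn) (measure M (L n)) \<le> a * measure M (L n)"
    by (simp add: m)
  moreover have "power_mean s \<delta>' (b * measure M (L n)) (measure M (L n))
      \<le> power_mean s \<delta>' (measure ?\<nu> Cn) (measure M (L n))"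
    using \<delta> \<delta>' bL \<nu>C L(5) by (intro power_mean_mono) auto
  moreover have "power_mean s \<delta>' (measure M (L n) * b) (measure M (L n) * 1)
      = measure M (L n) * power_mean s \<delta>' b 1"
    using \<delta> \<delta>' b L(5) by (intro power_mean_scale) auto
  ultimately have "measure M (L n) * power_mean s \<delta>' b 1 \<le> measure M (L n) * a"
    by (simp add: mult.commute)
  then show False using L(5)[of n] \<delta>'(3) by simp
qed

section \<open>From convex bodies to the whole space and Borel sets\<close>

lemma compact_open_power_mean_le:
  fixes M :: "'a::euclidean_space measure"
  assumes fin: "finite_measure M" and sets: "sets M = sets borel" and sc: "s_concave s M" and s: "s \<le> 1"
    and A: "open A" and B: "compact B" "B \<subseteq> A" and \<delta>: "0 \<le> \<delta>" "\<delta> < 1"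
    and thin: "\<And>x v T. x \<in> B \<Longrightarrow> norm v = 1 \<Longrightarrow> 0 \<le> T \<Longrightarrow>
      measure lborel {\<tau> \<in> {0..T}. x + \<tau> *\<^sub>R v \<notin> A} \<le> \<delta> * T"
    and pos: "measure M B > 0"
  shows "power_mean s \<delta> (measure M B) (measure M UNIV) \<le> measure M A"
proof -
  interpret finite_measure M by fact
  have [simp]: "S \<in> sets M" if "S \<in> sets borel" for S using that sets by simp
  have Bm: "B \<in> sets borel" using B(1) compact_imp_closed borel_closed by blast
  obtain R :: nat where R: "B \<subseteq> cball 0 (real R)"
  proof -
    obtain c where c: "\<And>x. x \<in> B \<Longrightarrow> norm x \<le> c"
      using compact_imp_bounded[OF B(1)] unfolding bounded_iff by blast
    obtain R :: nat where "c < real R" using reals_Archimedean2 ..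
    then have "B \<subseteq> cball 0 (real R)" using c by force
    then show thesis by (rule that)
  qed
  \<comment> \<open>Balls serve as the convex bodies. From radius \<open>R\<close> on they contain
    \<open>B\<close>, so only the second argument of the mean varies, and it tends to the total
    mass.\<close>
  have "(\<Union>n. cball (0::'a) (real n)) = UNIV"
    using real_arch_simple by (auto simp: set_eq_iff)
  moreover have "(\<lambda>n. measure M (cball 0 (real n))) \<longlonglongrightarrow> measure M (\<Union>n. cball 0 (real n))"
    by (intro finite_Lim_measure_incseq) (auto simp: incseq_def)
  ultimately have "(\<lambda>n. measure M (cball 0 (real n))) \<longlonglongrightarrow> measure M UNIV" by simp
  moreover have "measure M B \<le> measure M UNIV" using Bm by (intro finite_measure_mono) auto
  ultimately have "(\<lambda>n. power_mean s \<delta> (measure M B) (measure M (cball 0 (real n))))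
      \<longlonglongrightarrow> power_mean s \<delta> (measure M B) (measure M UNIV)"
    using \<delta> pos by (intro tendsto_power_mean tendsto_const) auto
  moreover have "power_mean s \<delta> (measure M B) (measure M (cball 0 (real n))) \<le> measure M A" if "R \<le> n" for n
  proof -
    have "cball 0 (real R) \<subseteq> cball 0 (real n)" using that by auto
    then have eq: "cball 0 (real n) \<inter> B = B" using R by blast
    have "power_mean s \<delta> (measure M B) (measure M (cball 0 (real n))) \<le> measure M (cball 0 (real n) \<inter> A)"
      using convex_body_power_mean_le[OF fin sets sc s compact_cball convex_cball A B \<delta> thin, of 0 "real n"] pos
      by (simp add: eq)
    also have "\<dots> \<le> measure M A" using A by (intro finite_measure_mono) auto
    finally show ?thesis .
  qed
  ultimately show ?thesis by (intro LIMSEQ_le_const2) auto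
qed

text \<open>Shrinking \<open>B\<close> to a compact set and enlarging \<open>A\<close> to an open
  one both preserve thinness: there are fewer base points, and the complement is smaller. For a
  fixed compact part the outer regularity of \<open>A\<close> gives the bound; the inner regularity
  of \<open>B\<close> and the continuity of the mean finish.\<close>

theorem s_concave_dilation:
  fixes M :: "'a::euclidean_space measure"
  assumes fin: "finite_measure M" and sets: "sets M = sets borel" and sc: "s_concave s M" and s: "s \<le> 1"
    and A: "A \<in> sets borel" and B: "B \<in> sets borel" "B \<subseteq> A" and \<delta>: "0 \<le> \<delta>" "\<delta> < 1"
    and thin: "\<And>x v T. x \<in> B \<Longrightarrow> norm v = 1 \<Longrightarrow> 0 \<le> T \<Longrightarrow>
      measure lborel {\<tau> \<in> {0..T}. x + \<tau> *\<^sub>R v \<notin> A} \<le> \<delta> * T"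
    and pos: "measure M B > 0"
  shows "power_mean s \<delta> (measure M B) (measure M UNIV) \<le> measure M A"
proof -
  interpret finite_measure M by fact
  have [simp]: "S \<in> sets M" if "S \<in> sets borel" for S using that sets by simp
  have fins: "emeasure M (space M) \<noteq> \<infinity>" by (simp add: emeasure_eq_measure)
  have inner: "\<exists>C. compact C \<and> C \<subseteq> B \<and> measure M B - r < measure M C" if "r > 0" for r
  proof (cases "measure M B - r < 0")
    case True
    then show ?thesis by (intro exI[of _ "{}"]) auto
  next
    case False
    have "ennreal (measure M B - r) < emeasure M B"
      unfolding emeasure_eq_measure using that False by (subst ennreal_less_iff) auto
    then have "\<exists>C. C \<subseteq> B \<and> compact C \<and> ennreal (measure M B - r) < emeasure M C"
      unfolding inner_regular[OF sets fins B(1)] less_SUP_iff by blast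
    then show ?thesis using False by (auto simp: emeasure_eq_measure ennreal_less_iff)
  qed
  have outer: "\<exists>U. open U \<and> A \<subseteq> U \<and> measure M U < measure M A + r" if "r > 0" for r
  proof -
    have "emeasure M A < ennreal (measure M A + r)"
      using that by (simp add: emeasure_eq_measure ennreal_less_iff)
    then have "\<exists>U. A \<subseteq> U \<and> open U \<and> emeasure M U < ennreal (measure M A + r)"
      unfolding outer_regular[OF sets fins A] INF_less_iff by blast
    then show ?thesis by (auto simp: emeasure_eq_measure ennreal_less_iff)
  qed
  have comp: "power_mean s \<delta> (measure M C) (measure M UNIV) \<le> measure M A"
    if C: "compact C" "C \<subseteq> B" "measure M C > 0" for C
  proof (rule field_le_epsilon)
    fix r :: real assume "r > 0"
    then obtain U where U: "open U" "A \<subseteq> U" "measure M U < measure M A + r" using outer by blast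
    have "power_mean s \<delta> (measure M C) (measure M UNIV) \<le> measure M U"
    proof (rule compact_open_power_mean_le[OF fin sets sc s U(1) C(1) _ \<delta> _ C(3)])
      show "C \<subseteq> U" using C B U by blast
      fix x v :: 'a and T :: real assume x: "x \<in> C" "norm v = 1" "0 \<le> T"
      define g where "g \<tau> = x + \<tau> *\<^sub>R v" for \<tau>
      have gm: "g -` S \<in> sets lborel" if "S \<in> sets borel" for S
      proof -
        have "g \<in> borel_measurable borel"
          unfolding g_def by (intro borel_measurable_continuous_onI continuous_intros)
        then show ?thesis using measurable_sets[of g borel borel S] that by simp
      qed
      have eq: "{\<tau> \<in> {0..T}. x + \<tau> *\<^sub>R v \<notin> S} = {0..T} \<inter> g -` (- S)" for S by (auto simp: g_def)
      have "measure lborel ({0..T} \<inter> g -` (- U)) \<le> measure lborel ({0..T} \<inter> g -` (- A))"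
      proof (rule measure_mono_fmeasurable)
        show "{0..T} \<inter> g -` (- U) \<subseteq> {0..T} \<inter> g -` (- A)" using U(2) by auto
        show "{0..T} \<inter> g -` (- U) \<in> sets lborel" using gm[of "- U"] U(1) by auto
        have "{0..T} \<in> fmeasurable lborel" using x(3) by (intro fmeasurableI) auto
        then show "{0..T} \<inter> g -` (- A) \<in> fmeasurable lborel"
          by (rule fmeasurableI2) (use gm[of "- A"] A in auto)
      qed
      also have "\<dots> \<le> \<delta> * T" using thin[of x v T] x C(2) unfolding eq by blast
      finally show "measure lborel {\<tau> \<in> {0..T}. x + \<tau> *\<^sub>R v \<notin> U} \<le> \<delta> * T" unfolding eq .
    qed
    then show "power_mean s \<delta> (measure M C) (measure M UNIV) \<le> measure M A + r" using U(3) by simp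
  qed
  obtain C where C: "\<And>n. compact (C n)" "\<And>n. C n \<subseteq> B"
    "\<And>n. measure M B - 1 / real (Suc n) < measure M (C n)"
    using inner[of "1 / real (Suc n)" for n] by (metis of_nat_0_less_iff zero_less_Suc zero_less_divide_1_iff)
  have "(\<lambda>n. measure M (C n)) \<longlonglongrightarrow> measure M B"
  proof (rule tendsto_sandwich)
    show "(\<lambda>n. measure M B - 1 / real (Suc n)) \<longlonglongrightarrow> measure M B"
      using tendsto_diff[OF tendsto_const lim_1_over_n[THEN LIMSEQ_Suc], of "measure M B"] by simp
    show "eventually (\<lambda>n. measure M B - 1 / real (Suc n) \<le> measure M (C n)) sequentially"
      by (intro always_eventually allI less_imp_le C(3))
    show "eventually (\<lambda>n. measure M (C n) \<le> measure M B) sequentially"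
      using C(2) B(1) by (intro always_eventually allI finite_measure_mono) auto
  qed simp
  moreover have "measure M B \<le> measure M UNIV" using B by (intro finite_measure_mono) auto
  ultimately have "(\<lambda>n. power_mean s \<delta> (measure M (C n)) (measure M UNIV))
      \<longlonglongrightarrow> power_mean s \<delta> (measure M B) (measure M UNIV)"
    using \<delta> pos by (intro tendsto_power_mean tendsto_const) auto
  moreover have "eventually (\<lambda>n. power_mean s \<delta> (measure M (C n)) (measure M UNIV) \<le> measure M A) sequentially"
    using order_tendstoD(1)[OF \<open>(\<lambda>n. measure M (C n)) \<longlonglongrightarrow> measure M B\<close> pos]
    by (rule eventually_mono) (use comp C(1,2) in blast)
  ultimately show ?thesis by (intro tendsto_upperbound) auto
qed

text \<open>If the part \<open>J\<close> of a segment from \<open>x\<close> on which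
  \<open>\<bar>f\<bar> \<le> l\<close> took up more than \<open>1 / t\<close> of it, the Remez
  inequality would bound \<open>\<bar>f\<bar>\<close> on the whole segment by
  \<open>l * u t\<close>. But \<open>x\<close> itself is on the segment.\<close>

lemma remez_function_thin:
  fixes f :: "'a::euclidean_space \<Rightarrow> real"
  assumes f: "f \<in> borel_measurable borel" and u: "remez_function f u" and t: "t > 1" and l: "l > 0"
    and x: "\<bar>f x\<bar> > l * u t" and v: "norm v = 1" and T: "0 \<le> T"
  shows "measure lborel {\<tau> \<in> {0..T}. \<not> \<bar>f (x + \<tau> *\<^sub>R v)\<bar> > l} \<le> 1 / t * T"
proof (rule ccontr)
  let ?S = "{\<tau> \<in> {0..T}. \<not> \<bar>f (x + \<tau> *\<^sub>R v)\<bar> > l}"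
  assume neg: "\<not> ?thesis"
  define g where "g \<tau> = x + \<tau> *\<^sub>R v" for \<tau>
  have inj: "g \<tau> = g \<tau>' \<longleftrightarrow> \<tau> = \<tau>'" for \<tau> \<tau>' using v by (auto simp: g_def)
  have cg: "continuous_on S g" for S unfolding g_def by (intro continuous_intros)
  define I where "I = g ` {0..T}"
  define J where "J = I \<inter> {y. \<bar>f y\<bar> \<le> l}"
  have "closed I" unfolding I_def by (intro compact_imp_closed compact_continuous_image cg) auto
  then have Jm: "J \<in> sets borel" using f unfolding J_def by (intro sets.Int) (measurable, auto)
  have conv: "convex I"
  proof (rule convexI)
    fix y z and a b :: real
    assume "y \<in> I" "z \<in> I" and ab: "0 \<le> a" "0 \<le> b" "a + b = 1"
    then obtain p q where pq: "p \<in> {0..T}" "q \<in> {0..T}" "y = g p" "z = g q" by (auto simp: I_def)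
    have "a * p + b * q \<in> {0..T}"
      using convexD[OF convex_real_interval(5)[of 0 T] pq(1,2) ab] by simp
    moreover have "a *\<^sub>R y + b *\<^sub>R z = (a + b) *\<^sub>R x + (a * p + b * q) *\<^sub>R v"
      by (simp add: pq g_def algebra_simps)
    then have "a *\<^sub>R y + b *\<^sub>R z = g (a * p + b * q)" by (simp add: ab(3) g_def)
    ultimately show "a *\<^sub>R y + b *\<^sub>R z \<in> I" by (auto simp: I_def)
  qed
  have "{r. g r \<in> I} = {0..T}" by (auto simp: I_def inj)
  then have mI: "line_measure x v I = ennreal T" using T by (simp add: line_measure_def flip: g_def)
  have JS: "{r. g r \<in> J} = ?S" by (auto simp: J_def I_def inj) (auto simp: g_def)
  have "emeasure lborel ?S \<le> emeasure lborel {0..T}" by (intro emeasure_mono) auto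
  then have "emeasure lborel ?S \<noteq> \<infinity>" using T by (auto simp: top_unique)
  then have mJ: "line_measure x v J = ennreal (measure lborel ?S)"
    unfolding line_measure_def g_def[symmetric] JS by (intro emeasure_eq_ennreal_measure) simp
  have "T < t * measure lborel ?S" using neg t by (simp add: field_simps)
  then have "line_measure x v I < ennreal t * line_measure x v J"
    unfolding mI mJ using t T by (simp add: ennreal_mult[symmetric] ennreal_less_iff)
  moreover have "I \<subseteq> line x v" by (auto simp: I_def line_def g_def)
  moreover have "J \<subseteq> I" by (simp add: J_def)
  ultimately have le: "(SUP x\<in>I. ennreal \<bar>f x\<bar>) \<le> ennreal (u t) * (SUP x\<in>J. ennreal \<bar>f x\<bar>)"
    using u v t Jm conv unfolding remez_function_def by blast
  have ut: "u t \<ge> 1" using u t unfolding remez_function_def by blast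
  have "x \<in> I" using T by (auto simp: I_def g_def intro!: image_eqI[of _ _ 0])
  then have "ennreal \<bar>f x\<bar> \<le> (SUP x\<in>I. ennreal \<bar>f x\<bar>)" by (rule SUP_upper)
  also note le
  also have "(SUP x\<in>J. ennreal \<bar>f x\<bar>) \<le> ennreal l" by (intro SUP_least) (auto simp: J_def intro: ennreal_leI)
  also have "ennreal (u t) * ennreal l = ennreal (l * u t)" using ut l by (simp add: ennreal_mult mult.commute)
  finally show False using x ut l by (simp add: mult_left_mono)
qed

theorem theorem2:
  fixes f :: "real ^ 'n \<Rightarrow> real" and u :: "real \<Rightarrow> real"
    and M :: "(real ^ 'n) measure" and s t l :: real
  assumes "f \<in> borel_measurable borel"
    and "remez_function f u"
    and "s \<le> 1"
    and "prob_space M" and "sets M = sets borel" and "s_concave s M"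
    and "t > 1" and "l > 0"
    and "measure M {x. \<bar>f x\<bar> > l * u t} > 0"
  shows "(s \<noteq> 0 \<longrightarrow>
            measure M {x. \<bar>f x\<bar> > l} \<ge>
              (1 / t * measure M {x. \<bar>f x\<bar> > l * u t} powr s + 1 - 1 / t) powr (1 / s)) \<and>
         (s = 0 \<longrightarrow>
            measure M {x. \<bar>f x\<bar> > l * u t} \<le> measure M {x. \<bar>f x\<bar> > l} powr t)"
proof -
  interpret prob_space M by fact
  note [measurable] = assms(1)
  let ?A = "{x. \<bar>f x\<bar> > l}" and ?B = "{x. \<bar>f x\<bar> > l * u t}"
  have "u t \<ge> 1" using assms(2,7) unfolding remez_function_def by blast
  then have "l \<le> l * u t" using assms(8) by simp
  then have BA: "?B \<subseteq> ?A" by auto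
  have "space M = UNIV" using sets_eq_imp_space_eq[OF assms(5)] by simp
  then have one: "measure M UNIV = 1" using prob_space by simp
  \<comment> \<open>The total mass is one, which turns the second term of the mean into
    \<open>1 - 1 / t\<close> for \<open>s \<noteq> 0\<close> and the second factor into one for
    \<open>s = 0\<close>.\<close>
  have key: "power_mean s (1 / t) (measure M ?B) (measure M UNIV) \<le> measure M ?A"
  proof (rule s_concave_dilation[OF _ assms(5,6,3) _ _ BA _ _ _ assms(9)])
    show "finite_measure M" by unfold_locales
    show "?A \<in> sets borel" "?B \<in> sets borel" by measurable
    show "measure lborel {\<tau> \<in> {0..T}. x + \<tau> *\<^sub>R v \<notin> ?A} \<le> 1 / t * T"
      if "x \<in> ?B" "norm v = 1" "0 \<le> T" for x v T
      using remez_function_thin[OF assms(1,2,7,8), of x v T] that by simp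
  qed (use assms(7) in auto)
  show ?thesis
  proof (intro conjI impI)
    assume "s \<noteq> 0"
    then show "measure M ?A \<ge> (1 / t * measure M ?B powr s + 1 - 1 / t) powr (1 / s)"
      using key by (simp add: power_mean_def one add_diff_eq)
  next
    assume "s = 0"
    then have "measure M ?B powr (1 / t) \<le> measure M ?A" using key by (simp add: power_mean_def one)
    then have "(measure M ?B powr (1 / t)) powr t \<le> measure M ?A powr t"
      using assms(7) by (intro powr_mono2) auto
    then show "measure M ?B \<le> measure M ?A powr t" using assms(7) by (simp add: powr_powr)
  qed
qed

end
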